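(* Let $n\ge 2$ and $H\ge 1$ be integers and let $p$ be the smallest prime divisor of $n$. Then there are constants $c_n,C_n>0$ depending only on $n$ such that $c_n H^{n/p}\le I_n(H)\le C_n H^{n/p}$.
   Context: A polynomial $f\in\mathbb{C}[X]$ is degenerate if it has two distinct roots whose quotient is a root of unity. $S_n(H)$ is the set of monic polynomials $X^n+a_1X^{n-1}+\dots+a_n\in\mathbb{Z}[X]$ that are degenerate with $|a_j|\le H$ for all $j$. A polynomial in $\mathbb{Z}[X]$ is called irreducible if it is irreducible in $\mathbb{Q}[X]$, and reducible otherwise. $I_n(H)$ is the number of irreducible polynomials in $S_n(H)$.
   Formalization: The lower bound is not claimed when n is an odd prime and H = 1: there every irreducible degenerate polynomial has the form X^n ± a_n with |a_n| ≤ 1, so I_n(1) = 0 and the printed lower bound fails; all other cases are covered. *)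

theory Defs
  imports
    Complex_Main
    "HOL-Computational_Algebra.Polynomial"
    "HOL-Computational_Algebra.Primes"
begin

definition root_of_unity :: "complex \<Rightarrow> bool" where
  "root_of_unity z \<longleftrightarrow> (\<exists>k::nat. k > 0 \<and> z ^ k = 1)"

(* If y = 0 then x / y = 0, which is not a root of unity, so the root 0 never contributes. *)
definition degenerate :: "complex poly \<Rightarrow> bool" where
  "degenerate f \<longleftrightarrow>
     (\<exists>x y. poly f x = 0 \<and> poly f y = 0 \<and> x \<noteq> y \<and> root_of_unity (x / y))"

(* The coefficient called a_j in X^n + a_1 X^(n-1) + ... + a_n is coeff f (n - j). *)
definition S_n :: "nat \<Rightarrow> nat \<Rightarrow> int poly set" where
  "S_n n H = {f. degree f = n \<and> lead_coeff f = 1 \<and>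
               (\<forall>j\<in>{1..n}. \<bar>coeff f (n - j)\<bar> \<le> int H) \<and>
               degenerate (map_poly of_int f)}"

(* Irreducibility is taken in Q[X], hence the passage to rat poly. *)
definition I_n :: "nat \<Rightarrow> nat \<Rightarrow> nat" where
  "I_n n H = card {f \<in> S_n n H. irreducible (map_poly rat_of_int f)}"

lemma finite_S_n: "finite (S_n n H)"
proof (rule finite_subset)
  let ?B = "{- int H - 1..int H + 1}"
  show "S_n n H \<subseteq> Poly ` {xs. set xs \<subseteq> ?B \<and> length xs = n + 1}"
  proof
    fix f assume f: "f \<in> S_n n H"
    hence "f \<noteq> 0" by (auto simp: S_n_def)
    have b: "\<bar>coeff f i\<bar> \<le> int H + 1" if "i \<le> n" for i
    proof (cases "i = n")
      case True
      with f show ?thesis by (auto simp: S_n_def)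
    next
      case False
      with that have "n - i \<in> {1..n}" "n - (n - i) = i" by auto
      with f have "\<bar>coeff f (n - (n - i))\<bar> \<le> int H" unfolding S_n_def by blast
      with \<open>n - (n - i) = i\<close> show ?thesis by simp
    qed
    have "set (coeffs f) \<subseteq> ?B"
    proof
      fix c assume "c \<in> set (coeffs f)"
      then obtain i where "i < length (coeffs f)" "c = coeffs f ! i"
        by (metis in_set_conv_nth)
      hence "i \<le> n" "c = coeff f i"
        using f \<open>f \<noteq> 0\<close> by (auto simp: length_coeffs_degree coeffs_nth S_n_def)
      with b[of i] show "c \<in> ?B" by auto
    qed
    moreover have "length (coeffs f) = n + 1"
      using f \<open>f \<noteq> 0\<close> by (simp add: length_coeffs_degree S_n_def)
    ultimately show "f \<in> Poly ` {xs. set xs \<subseteq> ?B \<and> length xs = n + 1}"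
      by (intro image_eqI[of _ _ "coeffs f"]) auto
  qed
  show "finite (Poly ` {xs. set xs \<subseteq> ?B \<and> length xs = n + 1})"
    by (intro finite_imageI finite_lists_length_eq) auto
qed

end

theory Submission
  imports Defs
    "Berlekamp_Zassenhaus.Factor_Bound"
    "Jordan_Normal_Form.Char_Poly"
begin

text \<open>
  Upper bound. There is an exponent \<open>N\<close>, depending only on \<open>n\<close>, such that \<open>x ^ N = y ^ N\<close> for any two
  roots \<open>x, y\<close> of a polynomial of degree \<open>n\<close> whose quotient is a root of unity: the quotient has
  bounded degree and all its conjugates lie on the unit circle. Let \<open>F\<close> be irreducible and degenerate. By
  conjugation, all fibres of \<open>x \<mapsto> x ^ N\<close> on the roots of \<open>F\<close> have the same size \<open>l \<ge> 2\<close>,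
  and the product \<open>\<gamma>\<close> of a fibre is a fixed rational polynomial in the common value of the
  \<open>N\<close>-th powers. So \<open>\<gamma>\<close> is an algebraic integer of degree at most \<open>n div l \<le> n div p\<close>,
  and the Mahler measure of its minimal polynomial \<open>S\<close> is at most that of \<open>F\<close>. There are
  \<open>O(H ^ (n div p))\<close> possible \<open>S\<close>, and \<open>S\<close> leaves boundedly many choices for a root \<open>\<alpha>\<close> of \<open>F\<close>,
  because \<open>\<alpha> ^ (l * N) = \<gamma> ^ N\<close>; and \<open>\<alpha>\<close> determines \<open>F\<close>.

  Lower bound. A polynomial in \<open>X ^ p\<close> with nonzero constant term is degenerate. For \<open>H \<ge> 2\<close> enough of
  them satisfy the Eisenstein criterion at \<open>2\<close>. For \<open>H = 1\<close> one takes \<open>X ^ 2 + 1\<close> if \<open>n = 2\<close>, and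
  \<open>X ^ n - X ^ k - 1\<close> with a proper divisor \<open>k > 1\<close> of \<open>n\<close> if \<open>n\<close> is composite.
\<close>

section \<open>Minimal polynomials and fibres over conjugate values\<close>

hide_const (open) Module.smult UnivPoly.coeff UnivPoly.monom

abbreviation complex_of_rat_poly :: "rat poly \<Rightarrow> complex poly" where
  "complex_of_rat_poly \<equiv> map_poly of_rat"

abbreviation eval_rat :: "rat poly \<Rightarrow> complex \<Rightarrow> complex" where
  "eval_rat q z \<equiv> poly (complex_of_rat_poly q) z"

interpretation of_rat_poly_hom: map_poly_inj_idom_hom "of_rat :: rat \<Rightarrow> complex" ..

lemma eval_rat_add [simp]: "eval_rat (p + q) z = eval_rat p z + eval_rat q z"
  and eval_rat_diff [simp]: "eval_rat (p - q) z = eval_rat p z - eval_rat q z"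
  and eval_rat_mult [simp]: "eval_rat (p * q) z = eval_rat p z * eval_rat q z"
  and eval_rat_smult [simp]: "eval_rat (smult c p) z = of_rat c * eval_rat p z"
  by (simp_all add: hom_distribs)

lemma eval_rat_const [simp]: "eval_rat [:c:] z = of_rat c"
  by (simp add: of_rat_hom.map_poly_pCons_hom)

lemma eval_rat_of_int [simp]:
  "eval_rat (of_int_poly f) z = poly (of_int_poly f) z"
  by (simp add: map_poly_map_poly o_def)

section \<open>Minimal polynomials over the rationals and Gauss's lemma\<close>

lemma minimal_rat_poly:
  assumes "f \<noteq> 0" "eval_rat f z = 0"
  obtains q where "irreducible q" "monic q" "eval_rat q z = 0"
    "\<And>g. eval_rat g z = 0 \<Longrightarrow> q dvd g"
proof -
  obtain q0 where q0: "q0 \<noteq> 0" "eval_rat q0 z = 0"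
    and min: "\<And>g. g \<noteq> 0 \<Longrightarrow> eval_rat g z = 0 \<Longrightarrow> degree q0 \<le> degree g"
    using ex_has_least_nat[of "\<lambda>g. g \<noteq> 0 \<and> eval_rat g z = 0" f degree] assms by auto
  define q where "q = smult (inverse (lead_coeff q0)) q0"
  have q: "monic q" "eval_rat q z = 0" "degree q = degree q0" "q \<noteq> 0"
    using q0 by (auto simp: q_def)
  have dvd: "q dvd g" if "eval_rat g z = 0" for g
  proof (rule ccontr)
    assume "\<not> q dvd g"
    then have nz: "g mod q \<noteq> 0" by (simp add: dvd_eq_mod_eq_0)
    have "eval_rat (g mod q) z = eval_rat (g - (g div q) * q) z"
      by (simp add: minus_div_mult_eq_mod)
    also have "\<dots> = 0" using that q by simp
    finally have "degree q0 \<le> degree (g mod q)" using min nz by blast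
    moreover have "degree (g mod q) < degree q" using degree_mod_less[of q g] nz q by auto
    ultimately show False using q by simp
  qed
  have "irreducible q"
  proof (rule irreducibleI)
    show "q \<noteq> 0" by (rule q)
    show "\<not> q dvd 1"
    proof
      assume "q dvd 1"
      then have "degree q = 0" by (simp add: is_unit_iff_degree q)
      then have "q = 1" using q(1) by (metis monic_degree_0)
      then show False using q(2) by simp
    qed
    fix a b assume ab: "q = a * b"
    then have "eval_rat a z = 0 \<or> eval_rat b z = 0" using q by auto
    then have "q dvd a \<or> q dvd b" using dvd by blast
    moreover have "b dvd 1" if "q dvd a"
    proof -
      have "a \<noteq> 0" "b \<noteq> 0" using ab q by auto
      then have "degree a + degree b \<le> degree a"
        using dvd_imp_degree_le[OF that] ab by (simp add: degree_mult_eq)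
      then show ?thesis by (simp add: is_unit_iff_degree \<open>b \<noteq> 0\<close>)
    qed
    moreover have "a dvd 1" if "q dvd b"
    proof -
      have "a \<noteq> 0" "b \<noteq> 0" using ab q by auto
      then have "degree a + degree b \<le> degree b"
        using dvd_imp_degree_le[OF that] ab by (simp add: degree_mult_eq)
      then show ?thesis by (simp add: is_unit_iff_degree \<open>a \<noteq> 0\<close>)
    qed
    ultimately show "a dvd 1 \<or> b dvd 1" by blast
  qed
  with q dvd show ?thesis using that by blast
qed

text \<open>This stands in for Galois conjugation: a rational relation that holds at one root of an
  irreducible polynomial holds at all its roots.\<close>

lemma irreducible_dvd_if_common_root:
  assumes "irreducible q" "eval_rat q z = 0" "eval_rat g z = 0"
  shows "q dvd g"
proof -
  obtain m where m: "irreducible m" "eval_rat m z = 0" "\<And>g. eval_rat g z = 0 \<Longrightarrow> m dvd g"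
    using minimal_rat_poly[of q z] assms by (metis not_irreducible_zero)
  have "q dvd m \<or> m dvd 1" using m(3)[OF assms(2)] assms(1) by (metis irreducibleD')
  then have "q dvd m" using m(1) irreducible_not_unit by blast
  then show ?thesis using m(3)[OF assms(3)] by (metis dvd_trans)
qed

lemma irreducible_rat_poly_degree_pos: "irreducible (q :: rat poly) \<Longrightarrow> degree q > 0"
  by (metis gr0I irreducible_not_unit is_unit_iff_degree not_irreducible_zero)

text \<open>A multiple root would be shared with the derivative, which \<open>q\<close> would then
  divide although the degree of the derivative is smaller.\<close>

lemma rsquarefree_irreducible:
  assumes "irreducible q"
  shows "rsquarefree (complex_of_rat_poly q)"
  unfolding rsquarefree_roots
proof (intro allI notI, elim conjE)
  fix z assume z: "eval_rat q z = 0" "poly (pderiv (complex_of_rat_poly q)) z = 0"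
  have "eval_rat (pderiv q) z = 0" using z(2) by (simp add: of_rat_hom.map_poly_pderiv)
  then have "q dvd pderiv q" using irreducible_dvd_if_common_root assms z(1) by blast
  moreover have "pderiv q \<noteq> 0"
    using irreducible_rat_poly_degree_pos[OF assms] by (simp add: pderiv_eq_0_iff)
  ultimately have "degree q \<le> degree (pderiv q)" by (rule dvd_imp_degree_le)
  then show False using irreducible_rat_poly_degree_pos[OF assms] by (simp add: degree_pderiv)
qed

text \<open>Gauss's lemma: the integer polynomial \<open>rg\<close> proportional to \<open>g\<close>
  divides \<open>P\<close> over the integers, so its leading coefficient is a unit, and the positive
  scaling factor makes it 1.\<close>

lemma monic_rat_factor_of_int:
  fixes P :: "int poly" and g :: "rat poly"
  assumes "monic P" "monic g" "g dvd of_int_poly P"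
  obtains G where "monic G" "g = of_int_poly G"
proof -
  obtain r rg where rg: "rat_to_normalized_int_poly g = (r, rg)" by force
  note * = rat_to_normalized_int_poly[OF rg]
  obtain h where "of_int_poly P = g * h" using assms(3) by blast
  from rat_to_int_factor_explicit[OF this rg]
  obtain h' where h': "P = rg * smult (content P) h'" by blast
  have "lead_coeff rg * lead_coeff (smult (content P) h') = 1"
    using assms(1) h' by (metis lead_coeff_mult)
  then have unit: "\<bar>lead_coeff rg\<bar> = 1" by (metis zmult_eq_1_iff abs_1 abs_minus_cancel)
  have "r * of_int (lead_coeff rg) = 1"
    using assms(2) *(1) by (metis lead_coeff_smult of_int_hom.hom_lead_coeff)
  moreover from this have "lead_coeff rg > 0"
    using *(2) zero_less_mult_pos[of r "of_int (lead_coeff rg)"] by simp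
  ultimately have "lead_coeff rg = 1" "r = 1" using unit by auto
  then show ?thesis using that[of rg] *(1) by simp
qed

section \<open>Fibres of a rational polynomial over conjugate values\<close>

lemma comm_ring_hom_eval_rat: "comm_ring_hom (\<lambda>c. eval_rat c z)"
  by standard auto

text \<open>The fibre over \<open>z\<close> is the root set of the gcd of \<open>f\<close> and
  \<open>u - z\<close>. Over the field Q[Y]/(q) this gcd is found once, as a polynomial
  \<open>D\<close> with coefficients in Q[Y]; substituting any root \<open>z\<close> of
  \<open>q\<close> for Y gives the gcd at \<open>z\<close>. So the fibre has \<open>degree D\<close>
  elements, and its product is, up to sign, the constant coefficient of \<open>D\<close> at
  \<open>z\<close>.\<close>

lemma conjugate_fibres:
  assumes q: "irreducible q" and f: "monic f" "rsquarefree (complex_of_rat_poly f)"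
  obtains l r where
    "\<And>z. eval_rat q z = 0 \<Longrightarrow> card {x. eval_rat f x = 0 \<and> eval_rat u x = z} = l"
    "\<And>z. eval_rat q z = 0 \<Longrightarrow> \<Prod>{x. eval_rat f x = 0 \<and> eval_rat u x = z} = eval_rat r z"
proof -
  \<comment> \<open>The setting is Q[Y][X]: \<open>F\<close> is f(X), \<open>U\<close> is u(X) - Y,
    \<open>J\<close> is the ideal generated by \<open>F\<close>, \<open>U\<close> and q(Y), and
    \<open>ev z\<close> substitutes \<open>z\<close> for Y.\<close>
  define F where "F = map_poly (\<lambda>c. [:c:]) f"
  define U where "U = map_poly (\<lambda>c. [:c:]) u - [: [:0, 1:] :]"
  define J where "J D \<longleftrightarrow> (\<exists>A B E. D = A * F + B * U + smult q E)" for D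
  define ev where "ev z D = map_poly (\<lambda>c. eval_rat c z) D" for z D
  have ev_hom: "ev z (A + B) = ev z A + ev z B" "ev z (A * B) = ev z A * ev z B"
    "ev z (smult c A) = smult (eval_rat c z) (ev z A)" "ev z (A - B) = ev z A - ev z B" for z A B c
  proof -
    interpret comm_ring_hom "\<lambda>c. eval_rat c z" by (rule comm_ring_hom_eval_rat)
    interpret h: map_poly_comm_ring_hom "\<lambda>c. eval_rat c z" ..
    show "ev z (A + B) = ev z A + ev z B" "ev z (A * B) = ev z A * ev z B"
      "ev z (smult c A) = smult (eval_rat c z) (ev z A)" "ev z (A - B) = ev z A - ev z B"
      unfolding ev_def by (simp_all only: map_poly_hom_smult hom_distribs)
  qed
  have ev_F: "ev z F = complex_of_rat_poly f" for z
    by (simp add: ev_def F_def map_poly_map_poly o_def)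
  have ev_U: "ev z U = complex_of_rat_poly u - [:z:]" for z
    unfolding U_def ev_hom by (simp add: ev_def map_poly_map_poly o_def)
  have J_add: "J (A + B)" if "J A" "J B" for A B
  proof -
    obtain a b e a' b' e' where "A = a * F + b * U + smult q e" "B = a' * F + b' * U + smult q e'"
      using \<open>J A\<close> \<open>J B\<close> by (auto simp: J_def)
    then have "A + B = (a + a') * F + (b + b') * U + smult q (e + e')"
      by (simp add: algebra_simps smult_add_right)
    then show ?thesis unfolding J_def by blast
  qed
  have J_mult: "J (C * A)" if "J A" for C A
  proof -
    obtain a b e where "A = a * F + b * U + smult q e" using \<open>J A\<close> by (auto simp: J_def)
    then have "C * A = (C * a) * F + (C * b) * U + smult q (C * e)"
      by (simp add: algebra_simps)
    then show ?thesis unfolding J_def by blast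
  qed
  have J_diff: "J (A - B)" if "J A" "J B" for A B
    using J_add[OF that(1) J_mult[OF that(2), of "-1"]] by simp
  have J_q: "J (smult q E)" for E
    unfolding J_def by (rule exI[of _ 0], rule exI[of _ 0], rule exI[of _ E]) simp
  have J_F: "J F"
    unfolding J_def by (rule exI[of _ 1], rule exI[of _ 0], rule exI[of _ 0]) simp
  have J_U: "J U"
    unfolding J_def by (rule exI[of _ 0], rule exI[of _ 1], rule exI[of _ 0]) simp
  have "monic F" using f by (simp add: F_def)
  \<comment> \<open>Modulo \<open>q\<close> the coefficients form a field, so a monic element of
    least degree acts as a generator of the ideal.\<close>
  then obtain D where D: "monic D" "J D"
    and min: "\<And>G. monic G \<Longrightarrow> J G \<Longrightarrow> degree D \<le> degree G"
    using ex_has_least_nat[of "\<lambda>G. monic G \<and> J G" F degree] J_F by blast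
  have "D \<noteq> 0" using D(1) by auto
  text \<open>A remainder with leading coefficient prime to \<open>q\<close> could be made monic modulo \<open>q\<close>,
    contradicting minimality.\<close>
  have small: "ev z R = 0" if "J R" "R = 0 \<or> degree R < degree D" "eval_rat q z = 0" for R z
    using that
  proof (induction "degree R" arbitrary: R rule: less_induct)
    case less
    show ?case
    proof (cases "R = 0")
      case True then show ?thesis by (simp add: ev_def)
    next
      case False
      define c where "c = lead_coeff R"
      have "q dvd c"
      proof (rule ccontr)
        assume "\<not> q dvd c"
        then have "gcd c q = 1"
          using q prime_elem_imp_coprime[of q c] 
          by (metis coprime_imp_gcd_eq_1 gcd.commute irreducible_imp_prime_elem_gcd)
        then obtain a b where ab: "a * c + b * q = 1"
          using bezout_coefficients_fst_snd[of c q] by metis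
        \<comment> \<open>\<open>a\<close> inverts the leading coefficient modulo \<open>q\<close>;
          the added multiple of \<open>q\<close> corrects it to exactly 1.\<close>
        define G where "G = [:a:] * R + smult q (monom b (degree R))"
        have deg: "degree G \<le> degree R" unfolding G_def
          by (intro degree_add_le order.trans[OF degree_smult_le]) (auto simp: degree_monom_le)
        have co: "coeff G (degree R) = 1" using ab by (simp add: G_def c_def mult.commute)
        then have "degree G = degree R" using deg by (metis le_antisym le_degree zero_neq_one)
        then have "monic G" using co by simp
        moreover have "J G" unfolding G_def by (intro J_add J_mult J_q less)
        ultimately have "degree D \<le> degree R" using min \<open>degree G = degree R\<close> by metis
        then show False using less False by simp
      qed
      then obtain e where e: "c = q * e" by blast
      \<comment> \<open>The leading term vanishes at every root of \<open>q\<close>. Removing it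
        stays inside \<open>J\<close> and lowers the degree.\<close>
      define R' where "R' = R - smult q (monom e (degree R))"
      have R': "R = smult q (monom e (degree R)) + R'" by (simp add: R'_def)
      have J': "J R'" unfolding R'_def by (intro J_diff J_q less)
      have "coeff R' (degree R) = 0" using e by (simp add: R'_def c_def)
      moreover have "degree R' \<le> degree R" unfolding R'_def
        by (intro degree_diff_le order.trans[OF degree_smult_le]) (auto simp: degree_monom_le)
      ultimately have lt: "R' = 0 \<or> degree R' < degree R"
        by (metis le_neq_implies_less leading_coeff_0_iff)
      have "ev z R' = 0"
      proof (cases "R' = 0")
        case True then show ?thesis by (simp add: ev_def)
      next
        case False
        with lt less.prems show ?thesis by (intro less.hyps J') auto
      qed
      then show ?thesis unfolding R'[THEN arg_cong, of "ev z"] ev_hom using less.prems by simp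
    qed
  qed
  have D_dvd: "ev z D dvd ev z G" if "J G" "eval_rat q z = 0" for G z
  proof -
    \<comment> \<open>Since \<open>D\<close> is monic, pseudo-division is true division with
      remainder, and \<open>small\<close> makes the remainder vanish at \<open>z\<close>.\<close>
    obtain Q R where QR: "pseudo_divmod G D = (Q, R)" by force
    have "G = D * Q + R" "R = 0 \<or> degree R < degree D"
      using pseudo_divmod[OF \<open>D \<noteq> 0\<close> QR] D(1) by simp_all
    moreover from this have "J R"
      using J_diff[OF \<open>J G\<close> J_mult[OF D(2), of Q]] by (simp add: mult.commute)
    ultimately show ?thesis using small[of R z] that by (simp add: ev_hom)
  qed
  have ev_D: "degree (ev z D) = degree D" "monic (ev z D)" for z
  proof -
    interpret comm_ring_hom "\<lambda>c. eval_rat c z" by (rule comm_ring_hom_eval_rat)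
    have "coeff (ev z D) (degree D) = 1" using D(1) by (simp add: ev_def)
    moreover have "degree (ev z D) \<le> degree D" unfolding ev_def by (rule degree_map_poly_le)
    ultimately show "degree (ev z D) = degree D" "monic (ev z D)"
      by (metis le_antisym le_degree zero_neq_one)+
  qed
  have roots: "{x. eval_rat f x = 0 \<and> eval_rat u x = z} = {x. poly (ev z D) x = 0}"
    if z: "eval_rat q z = 0" for z
  proof -
    \<comment> \<open>Membership of \<open>D\<close> in \<open>J\<close> gives one inclusion;
      divisibility of \<open>f\<close> and \<open>u - z\<close> by the specialised \<open>D\<close>
      gives the other.\<close>
    obtain A B E where "D = A * F + B * U + smult q E" using D(2) by (auto simp: J_def)
    then have "ev z D = ev z A * complex_of_rat_poly f + ev z B * (complex_of_rat_poly u - [:z:])"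
      using z by (simp add: ev_hom ev_F ev_U)
    then have eq: "poly (ev z D) x = poly (ev z A) x * eval_rat f x + poly (ev z B) x * (eval_rat u x - z)" for x
      by simp
    obtain K where "complex_of_rat_poly f = ev z D * K"
      using D_dvd[OF J_F z] unfolding ev_F by blast
    then have f_eq: "eval_rat f x = poly (ev z D) x * poly K x" for x by simp
    obtain L where L: "complex_of_rat_poly u - [:z:] = ev z D * L"
      using D_dvd[OF J_U z] unfolding ev_U by blast
    have u_eq: "eval_rat u x - z = poly (ev z D) x * poly L x" for x
      using arg_cong[OF L, of "\<lambda>p. poly p x"] by simp
    show ?thesis
    proof (rule Collect_cong, rule iffI)
      fix x assume "eval_rat f x = 0 \<and> eval_rat u x = z"
      then show "poly (ev z D) x = 0" using eq[of x] by simp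
    next
      fix x assume "poly (ev z D) x = 0"
      then show "eval_rat f x = 0 \<and> eval_rat u x = z" using f_eq[of x] u_eq[of x] by simp
    qed
  qed
  have sqf: "rsquarefree (ev z D)" if "eval_rat q z = 0" for z
  proof -
    have "ev z D dvd complex_of_rat_poly f" using D_dvd[OF J_F that] unfolding ev_F .
    then obtain K where K: "complex_of_rat_poly f = ev z D * K" by blast
    show ?thesis unfolding rsquarefree_roots
    proof (intro allI notI, elim conjE)
      fix x assume "poly (ev z D) x = 0" "poly (pderiv (ev z D)) x = 0"
      then have "eval_rat f x = 0" "poly (pderiv (complex_of_rat_poly f)) x = 0"
        unfolding K by (simp_all add: pderiv_mult)
      then show False using f(2) unfolding rsquarefree_roots by blast
    qed
  qed
  show ?thesis
  \<comment> \<open>The witness for \<open>r\<close> is Vieta's formula for the product of all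
    roots.\<close>
  proof (rule that[of "degree D" "smult ((-1) ^ degree D) (coeff D 0)"])
    fix z assume z: "eval_rat q z = 0"
    have "ev z D \<noteq> 0" using ev_D(2)[of z] by auto
    then show "card {x. eval_rat f x = 0 \<and> eval_rat u x = z} = degree D"
      using rsquarefree_card_degree[of "ev z D"] sqf[OF z] ev_D unfolding roots[OF z] by simp
    have dec: "ev z D = (\<Prod>x | poly (ev z D) x = 0. [:- x, 1:])"
      using complex_poly_decompose_rsquarefree[OF sqf[OF z]] ev_D by simp
    have "poly (ev z D) 0 = (\<Prod>x | poly (ev z D) x = 0. poly [:- x, 1:] 0)"
      unfolding dec[THEN arg_cong, of "\<lambda>p. poly p 0"] poly_prod ..
    also have "\<dots> = (\<Prod>x | poly (ev z D) x = 0. (-1) * x)" by simp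
    also have "\<dots> = (-1) ^ card {x. poly (ev z D) x = 0} * \<Prod>{x. poly (ev z D) x = 0}"
      unfolding prod.distrib by simp
    also have "\<dots> = (-1) ^ degree D * \<Prod>{x. poly (ev z D) x = 0}"
      using rsquarefree_card_degree[of "ev z D"] sqf[OF z] ev_D \<open>ev z D \<noteq> 0\<close>
      by simp
    finally have "\<Prod>{x. poly (ev z D) x = 0} = (-1) ^ degree D * poly (ev z D) 0"
      by (simp add: mult.assoc[symmetric] flip: power_mult_distrib)
    also have "poly (ev z D) 0 = eval_rat (coeff D 0) z"
      by (simp add: poly_0_coeff_0 ev_def coeff_map_poly)
    finally show "\<Prod>{x. eval_rat f x = 0 \<and> eval_rat u x = z} = eval_rat (smult ((-1) ^ degree D) (coeff D 0)) z"
      unfolding roots[OF z] by (simp add: hom_distribs)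
  qed
qed

section \<open>Algebraic integers, Mahler measure and roots of unity\<close>

text \<open>\<open>z\<close> is an eigenvalue of an integer matrix \<open>A\<close>, so
  \<open>z ^ k\<close> is an eigenvalue of the \<open>k\<close>-th power of \<open>A\<close>, whose
  characteristic polynomial is monic with integer coefficients.\<close>

lemma algebraic_int_power:
  fixes z :: complex
  assumes "algebraic_int z"
  shows "algebraic_int (z ^ k)"
proof -
  obtain p where p: "poly (of_int_poly p) z = 0" "monic p"
    using assms by (auto simp: algebraic_int_altdef_ipoly)
  define n where "n = degree p"
  have "n > 0"
  proof (rule ccontr)
    assume "\<not> n > 0"
    then have "p = 1" using p(2) monic_degree_0[of p] by (simp add: n_def)
    then show False using p(1) by simp
  qed
  text \<open>The transpose of the companion matrix of \<open>p\<close>: it maps the vector of powers of \<open>z\<close>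
    to \<open>z\<close> times itself.\<close>
  define A :: "int mat" where
    "A = mat n n (\<lambda>(i, j). if Suc i < n then (if j = Suc i then 1 else 0) else - coeff p j)"
  define v where "v = vec n (\<lambda>i. z ^ i)"
  have A: "A \<in> carrier_mat n n" by (simp add: A_def)
  have v: "v \<in> carrier_vec n" by (simp add: v_def)
  let ?A = "map_mat complex_of_int A"
  have A': "?A \<in> carrier_mat n n" using A by simp
  have "(\<Sum>i\<le>n. of_int (coeff p i) * z ^ i) = 0"
    using p(1) by (simp add: poly_altdef n_def)
  moreover have "{..n} = insert n {0..<n}" by auto
  ultimately have zn: "z ^ n = - (\<Sum>i = 0..<n. of_int (coeff p i) * z ^ i)"
    using p(2) by (simp add: n_def eq_neg_iff_add_eq_0)
  have Av: "?A *\<^sub>v v = z \<cdot>\<^sub>v v"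
  proof (rule eq_vecI)
    fix i assume "i < dim_vec (z \<cdot>\<^sub>v v)"
    then have i: "i < n" by (simp add: v_def)
    have "(?A *\<^sub>v v) $ i = (\<Sum>j = 0..<n. of_int (A $$ (i, j)) * z ^ j)"
      using A i by (simp add: scalar_prod_def v_def)
    also have "\<dots> = z ^ Suc i"
    proof (cases "Suc i < n")
      case True
      then have "(\<Sum>j = 0..<n. of_int (A $$ (i, j)) * z ^ j) = (\<Sum>j = 0..<n. if j = Suc i then z ^ j else 0)"
        using i by (intro sum.cong) (auto simp: A_def)
      then show ?thesis using True by (simp add: sum.delta)
    next
      case False
      then have "(\<Sum>j = 0..<n. of_int (A $$ (i, j)) * z ^ j) = (\<Sum>j = 0..<n. - (of_int (coeff p j) * z ^ j))"
        using i by (intro sum.cong) (auto simp: A_def)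
      also have "\<dots> = z ^ n" by (simp add: zn sum_negf)
      finally show ?thesis using False i by (metis Suc_lessI)
    qed
    finally show "(?A *\<^sub>v v) $ i = (z \<cdot>\<^sub>v v) $ i" using i by (simp add: v_def)
  qed (use A in \<open>simp add: v_def\<close>)
  have pow: "(?A ^\<^sub>m k) *\<^sub>v v = z ^ k \<cdot>\<^sub>v v" for k
  proof (induction k)
    case 0
    show ?case using v A by simp
  next
    case (Suc k)
    have "(?A ^\<^sub>m Suc k) *\<^sub>v v = (?A ^\<^sub>m k) *\<^sub>v (?A *\<^sub>v v)"
      using pow_carrier_mat[OF A', of k] A' v by (simp add: assoc_mult_mat_vec[of _ n n _ n])
    also have "\<dots> = z \<cdot>\<^sub>v ((?A ^\<^sub>m k) *\<^sub>v v)"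
      unfolding Av using pow_carrier_mat[OF A', of k] v by (simp add: mult_mat_vec[of _ n n])
    also have "\<dots> = z ^ Suc k \<cdot>\<^sub>v v" unfolding Suc by (simp add: smult_smult_assoc)
    finally show ?case .
  qed
  have hom: "map_mat complex_of_int (A ^\<^sub>m k) = ?A ^\<^sub>m k"
    using A by (rule of_int_hom.mat_hom_pow)
  \<comment> \<open>The entry at index 0 is \<open>z ^ 0 = 1\<close>, even for \<open>z = 0\<close>;
    it exists because \<open>n > 0\<close>.\<close>
  have "v \<noteq> 0\<^sub>v n"
  proof
    assume "v = 0\<^sub>v n"
    then have "v $ 0 = 0\<^sub>v n $ 0" by (rule arg_cong)
    then show False using \<open>n > 0\<close> by (simp add: v_def)
  qed
  moreover have "dim_row (?A ^\<^sub>m k) = n" using pow_carrier_mat[OF A', of k] by blast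
  ultimately have "eigenvector (?A ^\<^sub>m k) v (z ^ k)"
    unfolding eigenvector_def using v pow[of k] by (simp only: simp_thms)
  then have "eigenvalue (?A ^\<^sub>m k) (z ^ k)" unfolding eigenvalue_def by (rule exI)
  then have "poly (char_poly (?A ^\<^sub>m k)) (z ^ k) = 0"
    using eigenvalue_root_char_poly[OF pow_carrier_mat[OF A', of k]] by blast
  then have "poly (of_int_poly (char_poly (A ^\<^sub>m k))) (z ^ k) = 0"
    using of_int_hom.char_poly_hom[OF pow_carrier_mat[OF A, of k], where 'a=complex] hom by simp
  moreover have "monic (char_poly (A ^\<^sub>m k))"
    using degree_monic_char_poly[OF pow_carrier_mat[OF A, of k]] by simp
  ultimately show ?thesis unfolding algebraic_int_altdef_ipoly by blast
qed

text \<open>All powers of \<open>x * y\<close> lie in the rational span of the products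
  \<open>x ^ i * y ^ j\<close> with \<open>i < degree f\<close> and \<open>j < degree g\<close>.
  Taking one power more than there are such products forces a linear relation.\<close>

lemma eval_rat_minimal_product:
  assumes "f \<noteq> 0" "eval_rat f x = 0" "g \<noteq> 0" "eval_rat g y = 0"
  obtains q where "q \<noteq> 0" "degree q \<le> degree f * degree g" "eval_rat q (x * y) = 0"
proof -
  interpret V: vector_space "\<lambda>c (v::complex). of_rat c * v"
    by standard (simp_all add: algebra_simps of_rat_add of_rat_mult)
  define m n where "m = degree f" and "n = degree g"
  define T where "T = (\<lambda>(i, j). x ^ i * y ^ j) ` ({..<m} \<times> {..<n})"
  have "finite T" "card T \<le> m * n"
    unfolding T_def using card_image_le[of "{..<m} \<times> {..<n}"] by (auto simp: card_cartesian_product)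
  have reduce: "\<exists>c. w ^ k = (\<Sum>i<degree h. of_rat (c i) * w ^ i)"
    if "h \<noteq> 0" "eval_rat h w = 0" for h w k
  proof -
    define R where "R = monom 1 k mod h"
    have "degree h > 0"
    proof (rule ccontr)
      assume "\<not> degree h > 0"
      then obtain c where "h = [:c:]" by (metis degree_eq_zeroE gr0I)
      then show False using that by simp
    qed
    then have "degree R < degree h" using degree_mod_less'[of h "monom 1 k"] R_def
      by (metis degree_0 degree_mod_less that(1))
    have "eval_rat R w = eval_rat (monom 1 k - (monom 1 k div h) * h) w"
      by (simp only: R_def minus_div_mult_eq_mod)
    also have "\<dots> = w ^ k" using that by (simp add: poly_monom)
    finally have "w ^ k = (\<Sum>i\<le>degree R. of_rat (coeff R i) * w ^ i)"
      by (simp add: poly_altdef)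
    also have "\<dots> = (\<Sum>i<degree h. of_rat (coeff R i) * w ^ i)"
      using \<open>degree R < degree h\<close> by (intro sum.mono_neutral_left) (auto simp: coeff_eq_0)
    finally show ?thesis by blast
  qed
  have span: "(x * y) ^ k \<in> V.span T" for k
  proof -
    obtain c where c: "x ^ k = (\<Sum>i<m. of_rat (c i) * x ^ i)" using reduce assms m_def by blast
    obtain d where d: "y ^ k = (\<Sum>i<n. of_rat (d i) * y ^ i)" using reduce assms n_def by blast
    have "(x * y) ^ k = (\<Sum>i<m. \<Sum>j<n. of_rat (c i * d j) * (x ^ i * y ^ j))"
      unfolding power_mult_distrib c d sum_product by (simp add: of_rat_mult mult_ac)
    also have "\<dots> \<in> V.span T"
      by (intro V.span_sum V.span_scale V.span_base) (auto simp: T_def)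
    finally show ?thesis .
  qed
  let ?P = "(\<lambda>k. (x * y) ^ k) ` {..m * n}"
  show ?thesis
  proof (cases "inj_on (\<lambda>k. (x * y) ^ k) {..m * n}")
    \<comment> \<open>If two powers coincide, the set of powers may be too small for the dimension
      count, but then X^a - X^b already annihilates \<open>x * y\<close>.\<close>
    case False
    then obtain a b where "a \<le> m * n" "b \<le> m * n" "a \<noteq> b" "(x * y) ^ a = (x * y) ^ b"
      unfolding inj_on_def by auto
    then show ?thesis
      by (intro that[of "monom 1 a - monom 1 b"] degree_diff_le)
         (auto simp: degree_monom_eq monom_eq_iff' m_def n_def poly_monom)
  next
    case True
    have "card ?P = Suc (m * n)" using True by (simp add: card_image)
    then have "V.dependent ?P"
      using V.independent_span_bound[OF \<open>finite T\<close>, of ?P] span \<open>card T \<le> m * n\<close> by fastforce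
    then obtain u where u: "\<exists>v\<in>?P. u v \<noteq> 0" "(\<Sum>v\<in>?P. of_rat (u v) * v) = 0"
      unfolding V.dependent_finite[OF finite_imageI[OF finite_atMost]] by blast
    define q where "q = (\<Sum>k\<le>m * n. monom (u ((x * y) ^ k)) k)"
    have co: "coeff q k = (if k \<le> m * n then u ((x * y) ^ k) else 0)" for k
      by (simp add: q_def coeff_sum sum.delta)
    show ?thesis
    proof (rule that[of q])
      show "q \<noteq> 0" using u(1) co by (metis atMost_iff coeff_0 imageE)
      show "degree q \<le> degree f * degree g" by (rule degree_le) (simp add: co m_def n_def)
      show "eval_rat q (x * y) = 0"
        using u(2) True by (simp add: q_def sum.reindex of_rat_poly_hom.hom_sum poly_sum poly_monom)
    qed
  qed
qed

section \<open>Counting integer polynomials; Mahler measure and coefficients\<close>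

definition monic_bounded :: "nat \<Rightarrow> nat \<Rightarrow> int poly set" where
  "monic_bounded m B = {f. monic f \<and> degree f = m \<and> (\<forall>i. \<bar>coeff f i\<bar> \<le> int B)}"

lemma finite_monic_bounded: "finite (monic_bounded m B)"
  and card_monic_bounded: "card (monic_bounded m B) \<le> (2 * B + 1) ^ m"
proof -
  let ?R = "\<lambda>f. restrict (coeff f) {..<m}" and ?P = "{..<m} \<rightarrow>\<^sub>E {- int B..int B}"
  have inj: "inj_on ?R (monic_bounded m B)"
  proof (rule inj_onI)
    fix f g assume f: "f \<in> monic_bounded m B" and g: "g \<in> monic_bounded m B" and eq: "?R f = ?R g"
    show "f = g"
    proof (rule poly_eqI)
      fix i
      consider "i < m" | "i = m" | "i > m" by linarith
      then show "coeff f i = coeff g i"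
      proof cases
        case 1
        then show ?thesis using fun_cong[OF eq, of i] by simp
      qed (use f g in \<open>auto simp: monic_bounded_def coeff_eq_0\<close>)
    qed
  qed
  have sub: "?R ` monic_bounded m B \<subseteq> ?P"
    by (auto simp: monic_bounded_def abs_le_iff PiE_def extensional_def restrict_def)
       (metis minus_le_iff)+
  have fin: "finite ?P" by (intro finite_PiE) auto
  show "finite (monic_bounded m B)" using inj_on_finite[OF inj sub fin] .
  have "card (monic_bounded m B) \<le> card ?P" using card_inj_on_le[OF inj sub fin] .
  also have "\<dots> = (2 * B + 1) ^ m" by (simp add: card_PiE nat_add_distrib nat_mult_distrib)
  finally show "card (monic_bounded m B) \<le> (2 * B + 1) ^ m" .
qed

text \<open>With simple roots the product runs over a set instead of a list, so it can later be
  regrouped by fibres.\<close>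

lemma mahler_measure_poly_rsquarefree:
  assumes "rsquarefree p" "monic p"
  shows "mahler_measure_poly p = (\<Prod>x | poly p x = 0. max 1 (cmod x))"
proof -
  have "p \<noteq> 0" using assms by auto
  then obtain xs where xs: "set xs = {x. poly p x = 0}" "distinct xs"
    using finite_distinct_list poly_roots_finite by metis
  have "p = smult 1 (\<Prod>x\<leftarrow>xs. [:- x, 1:])"
    using complex_poly_decompose_rsquarefree[OF assms(1)] assms(2) xs
    by (simp flip: prod.distinct_set_conv_list)
  then have "mahler_measure_poly p = (\<Prod>x\<leftarrow>xs. max 1 (cmod x))"
    using mahler_measure_poly_explicit[of 1 xs] by simp
  then show ?thesis using xs by (simp flip: prod.distinct_set_conv_list)
qed

lemma coeff_le_mahler_measure:
  "\<bar>real_of_int (coeff g k)\<bar> \<le> 2 ^ degree g * mahler_measure g"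
proof -
  have "real_of_int \<bar>coeff g k\<bar> \<le> real (degree g choose k) * mahler_measure g"
    by (rule Mignotte_bound)
  also have "\<dots> \<le> 2 ^ degree g * mahler_measure g"
  proof (rule mult_right_mono)
    have "degree g choose k \<le> 2 ^ degree g" by (rule binomial_le_pow2)
    then have "real (degree g choose k) \<le> real (2 ^ degree g)" by (simp only: of_nat_le_iff)
    then show "real (degree g choose k) \<le> 2 ^ degree g" by simp
  qed (rule mahler_measure_ge_0)
  finally show ?thesis by simp
qed

text \<open>Landau's inequality bounds the Mahler measure by the Euclidean norm of the coefficients;
  the square root of their number is then bounded crudely by \<open>Suc (degree f)\<close>.\<close>

lemma mahler_measure_le:
  assumes "\<And>i. \<bar>coeff f i\<bar> \<le> int H"
  shows "mahler_measure f \<le> real (Suc (degree f)) * real H"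
proof -
  have "mahler_measure f \<le> sqrt (\<Sum>a\<leftarrow>coeffs (of_int_poly f :: complex poly). (cmod a)\<^sup>2)"
    unfolding mahler_measure_def by (rule Landau_inequality)
  also have "(\<Sum>a\<leftarrow>coeffs (of_int_poly f :: complex poly). (cmod a)\<^sup>2)
      = (\<Sum>a\<leftarrow>coeffs f. (real_of_int a)\<^sup>2)"
    by (simp add: of_int_hom.coeffs_map_poly_hom o_def)
  also have "\<dots> \<le> (\<Sum>a\<leftarrow>coeffs f. (real H)\<^sup>2)"
  proof (rule sum_list_mono)
    fix a assume "a \<in> set (coeffs f)"
    then obtain i where "a = coeff f i" by (auto simp: coeffs_def split: if_splits)
    then have "\<bar>real_of_int a\<bar> \<le> real H" using assms[of i] by linarith
    then show "(real_of_int a)\<^sup>2 \<le> (real H)\<^sup>2" by (metis abs_le_square_iff abs_of_nat)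
  qed
  also have "\<dots> = real (length (coeffs f)) * (real H)\<^sup>2" by (simp add: sum_list_triv)
  also have "\<dots> \<le> real (Suc (degree f)) * (real H)\<^sup>2"
    by (intro mult_right_mono) (cases "f = 0"; simp add: length_coeffs_degree)+
  also have "\<dots> \<le> (real (Suc (degree f)) * real H)\<^sup>2"
    unfolding power_mult_distrib by (intro mult_right_mono) (auto simp: power2_eq_square)
  finally show ?thesis by (simp add: real_sqrt_abs abs_of_nonneg)
qed

text \<open>The minimal polynomial of such a root of unity divides some X^k - 1, so it has integer
  coefficients and all its roots on the unit circle. Its Mahler measure is 1, which bounds its
  coefficients by \<open>2 ^ d\<close> independently of \<open>k\<close>.\<close>

lemma finite_roots_of_unity_bounded_degree:
  "finite {\<zeta>. root_of_unity \<zeta> \<and> (\<exists>q. q \<noteq> 0 \<and> degree q \<le> d \<and> eval_rat q \<zeta> = 0)}"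
proof -
  let ?S = "\<Union>m\<le>d. monic_bounded m (2 ^ d)"
  have "{\<zeta>. root_of_unity \<zeta> \<and> (\<exists>q. q \<noteq> 0 \<and> degree q \<le> d \<and> eval_rat q \<zeta> = 0)}
    \<subseteq> (\<Union>G\<in>?S. {z. poly (of_int_poly G :: complex poly) z = 0})"
  proof safe
    fix \<zeta> q assume "root_of_unity \<zeta>" and q: "q \<noteq> 0" "degree q \<le> d" "eval_rat q \<zeta> = 0"
    then obtain k where k: "k > 0" "\<zeta> ^ k = 1" by (auto simp: root_of_unity_def)
    obtain m where m: "irreducible m" "monic m" "eval_rat m \<zeta> = 0"
      "\<And>g. eval_rat g \<zeta> = 0 \<Longrightarrow> m dvd g"
      using minimal_rat_poly[OF q(1,3)] by blast
    define P :: "int poly" where "P = monom 1 k - 1"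
    have degP: "degree P = k" unfolding P_def
      using k degree_add_eq_left[of "- 1" "monom (1 :: int) k"] by (simp add: degree_monom_eq)
    have "monic P" unfolding degP using k by (simp add: P_def)
    have P: "of_int_poly P = monom 1 k - (1 :: 'a :: field_char_0 poly)"
      by (simp add: P_def hom_distribs)
    have "m dvd of_int_poly P" by (rule m(4)) (use k in \<open>simp add: P poly_monom\<close>)
    then obtain G where G: "monic G" "m = of_int_poly G"
      using monic_rat_factor_of_int[OF \<open>monic P\<close> m(2)] by blast
    have cG: "complex_of_rat_poly m = of_int_poly G" by (simp add: G map_poly_map_poly o_def)
    have "degree G = degree m" by (simp add: G)
    also have "degree m \<le> d" using dvd_imp_degree_le[OF m(4)[OF q(3)] q(1)] q(2) by simp
    finally have deg: "degree G \<le> d" .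
    have "mahler_measure G = (\<Prod>x | eval_rat m x = 0. max 1 (cmod x))"
      unfolding mahler_measure_def cG[symmetric]
      by (rule mahler_measure_poly_rsquarefree[OF rsquarefree_irreducible[OF m(1)]]) (use m in simp)
    also have "\<dots> = 1"
    proof (rule prod.neutral, rule ballI)
      fix x assume x: "x \<in> {x. eval_rat m x = 0}"
      obtain K where K: "of_int_poly P = m * K" using \<open>m dvd of_int_poly P\<close> by (rule dvdE)
      have "eval_rat (of_int_poly P) x = 0" unfolding K eval_rat_mult using x by simp
      then have "x ^ k = 1" by (simp add: P poly_monom)
      then have "cmod x ^ k = 1 ^ k" by (simp flip: norm_power)
      then have "cmod x = 1" using k(1) power_eq_imp_eq_base[of "cmod x" k 1] by simp
      then show "max 1 (cmod x) = 1" by simp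
    qed
    finally have M: "mahler_measure G = 1" .
    have "\<bar>coeff G i\<bar> \<le> int (2 ^ d)" for i
    proof -
      have "\<bar>real_of_int (coeff G i)\<bar> \<le> 2 ^ degree G" using coeff_le_mahler_measure[of G i] M by simp
      also have "\<dots> \<le> 2 ^ d" using deg by simp
      finally show ?thesis by (simp flip: of_int_abs)
    qed
    then have "G \<in> ?S" using G(1) deg by (auto simp: monic_bounded_def)
    moreover have "poly (of_int_poly G) \<zeta> = 0" using m(3) cG by simp
    ultimately show "\<zeta> \<in> (\<Union>G\<in>?S. {z. poly (of_int_poly G :: complex poly) z = 0})" by blast
  qed
  moreover have "finite (\<Union>G\<in>?S. {z. poly (of_int_poly G :: complex poly) z = 0})"
  proof (rule finite_UN_I)
    show "finite ?S" by (intro finite_UN_I finite_atMost finite_monic_bounded)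
    fix G assume "G \<in> ?S"
    then have "G \<noteq> 0" by (auto simp: monic_bounded_def)
    then show "finite {z. poly (of_int_poly G :: complex poly) z = 0}"
      by (intro poly_roots_finite) simp
  qed
  ultimately show ?thesis by (rule finite_subset)
qed

text \<open>\<open>x / y\<close> is annihilated by a rational polynomial of degree at most
  \<open>n * n\<close>, so it lies in a finite set of roots of unity depending only on
  \<open>n\<close>. \<open>N\<close> is the product of one exponent for each member of that
  set.\<close>

lemma uniform_root_of_unity_exponent:
  obtains N :: nat where "N > 0"
    "\<And>f x y. f \<noteq> 0 \<Longrightarrow> degree f \<le> n \<Longrightarrow> eval_rat f x = 0 \<Longrightarrow> eval_rat f y = 0 \<Longrightarrow>
      root_of_unity (x / y) \<Longrightarrow> x ^ N = y ^ N"
proof -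
  define R where "R = {\<zeta>. root_of_unity \<zeta> \<and> (\<exists>q. q \<noteq> 0 \<and> degree q \<le> n * n \<and> eval_rat q \<zeta> = 0)}"
  have fin: "finite R" unfolding R_def by (rule finite_roots_of_unity_bounded_degree)
  have "\<forall>\<zeta>\<in>R. \<exists>k::nat. k > 0 \<and> \<zeta> ^ k = 1" by (auto simp: R_def root_of_unity_def)
  then obtain k where k: "\<And>\<zeta>. \<zeta> \<in> R \<Longrightarrow> k \<zeta> > (0::nat) \<and> \<zeta> ^ k \<zeta> = 1" by metis
  define N where "N = prod k R"
  show ?thesis
  proof (rule that[of N])
    show "N > 0" unfolding N_def using k by (intro prod_pos) auto
    fix f x y assume f: "f \<noteq> 0" "degree f \<le> n" "eval_rat f x = 0" "eval_rat f y = 0"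
      and ru: "root_of_unity (x / y)"
    have "y \<noteq> 0" using ru by (auto simp: root_of_unity_def power_0_left)
    \<comment> \<open>The reciprocal polynomial vanishes at \<open>inverse y\<close>, and its degree
      is at most that of \<open>f\<close>, even if 0 is a root of \<open>f\<close>.\<close>
    have "poly (reflect_poly (complex_of_rat_poly f)) (inverse y) = 0"
      using f(4) \<open>y \<noteq> 0\<close> by (simp add: poly_reflect_poly_nz)
    moreover have "reflect_poly (complex_of_rat_poly f) = complex_of_rat_poly (reflect_poly f)"
      by (rule poly_eqI) (simp add: coeff_reflect_poly coeff_map_poly)
    ultimately have "eval_rat (reflect_poly f) (inverse y) = 0" by simp
    then obtain q where q: "q \<noteq> 0" "degree q \<le> degree f * degree (reflect_poly f)"
      "eval_rat q (x * inverse y) = 0"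
      using eval_rat_minimal_product[OF f(1,3), of "reflect_poly f" "inverse y"] f(1) by auto
    have "degree f * degree (reflect_poly f) \<le> n * n"
      using f(2) degree_reflect_poly_le[of f] by (intro mult_le_mono) auto
    then have "x / y \<in> R" using q ru unfolding R_def by (auto simp: divide_inverse)
    then have "k (x / y) dvd N" "(x / y) ^ k (x / y) = 1"
      unfolding N_def using fin k by auto
    then have "(x / y) ^ N = 1" by (metis dvdE power_mult power_one)
    then show "x ^ N = y ^ N" using \<open>y \<noteq> 0\<close> by (simp add: power_divide)
  qed
qed

section \<open>The upper bound\<close>

text \<open>\<open>S\<close> is what gets counted in place of \<open>F\<close>: the minimal
  polynomial of the product \<gamma> of the fibre containing \<alpha>. Each conjugate of \<gamma> is
  the product of some fibre, and different conjugates come from different fibres; this bounds both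
  the degree and the Mahler measure of \<open>S\<close>.\<close>

lemma degenerate_resolvent:
  fixes F :: "int poly"
  assumes F: "monic F" "irreducible (of_int_poly F :: rat poly)" "degree F = n"
    and deg: "degenerate (of_int_poly F)"
    and N: "N > 0" "\<And>x y. poly (of_int_poly F) x = 0 \<Longrightarrow> poly (of_int_poly F) y = 0 \<Longrightarrow>
      root_of_unity (x / y) \<Longrightarrow> x ^ N = y ^ N"
    and p: "p > 0" "\<And>l. l \<ge> 2 \<Longrightarrow> l dvd n \<Longrightarrow> p \<le> l"
  obtains S and \<alpha> \<gamma> :: complex and l where "monic S" "degree S \<le> n div p"
    "\<And>i. \<bar>real_of_int (coeff S i)\<bar> \<le> 2 ^ degree S * mahler_measure F"
    "poly (of_int_poly S) \<gamma> = 0" "poly (of_int_poly F) \<alpha> = 0"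
    "l \<in> {1..n}" "\<alpha> ^ (l * N) = \<gamma> ^ N"
proof -
  define f where "f = (of_int_poly F :: rat poly)"
  define u where "u = (monom 1 N :: rat poly)"
  have ev_f: "eval_rat f w = poly (of_int_poly F) w" for w by (simp add: f_def)
  have ev_u: "eval_rat u w = w ^ N" for w by (simp add: u_def poly_monom)
  have cf: "complex_of_rat_poly f = of_int_poly F" by (simp add: f_def map_poly_map_poly o_def)
  have f: "monic f" "irreducible f" "degree f = n" using F by (simp_all add: f_def)
  have sqf: "rsquarefree (complex_of_rat_poly f)" by (rule rsquarefree_irreducible[OF f(2)])
  obtain x y where xy: "eval_rat f x = 0" "eval_rat f y = 0" "x \<noteq> y" "root_of_unity (x / y)"
    using deg by (auto simp: degenerate_def ev_f)
  define \<beta> where "\<beta> = x ^ N"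
  have y_\<beta>: "y ^ N = \<beta>" using N(2)[of x y] xy by (simp add: ev_f \<beta>_def)
  have alg_x: "algebraic_int x"
    unfolding algebraic_int_altdef_ipoly using xy(1) F(1) by (auto simp: ev_f)
  obtain P where P: "poly (of_int_poly P) \<beta> = 0" "monic P"
    using algebraic_int_power[OF alg_x, of N] unfolding algebraic_int_altdef_ipoly \<beta>_def by blast
  then have "eval_rat (of_int_poly P) \<beta> = 0" "of_int_poly P \<noteq> (0 :: rat poly)" by auto
  then obtain q where q: "irreducible q" "monic q" "eval_rat q \<beta> = 0"
    using minimal_rat_poly by metis
  have sqq: "rsquarefree (complex_of_rat_poly q)" by (rule rsquarefree_irreducible[OF q(1)])
  define fib where "fib z = {w. eval_rat f w = 0 \<and> eval_rat u w = z}" for z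
  define Z where "Z = {z. eval_rat q z = 0}"
  define W where "W = {w. eval_rat f w = 0}"
  \<comment> \<open>First use: the fibres of the \<open>N\<close>-th power map on the roots of
    \<open>f\<close>, over the conjugates of \<beta>.\<close>
  obtain l r where lr0:
    "\<And>z. eval_rat q z = 0 \<Longrightarrow> card {w. eval_rat f w = 0 \<and> eval_rat u w = z} = l"
    "\<And>z. eval_rat q z = 0 \<Longrightarrow> \<Prod>{w. eval_rat f w = 0 \<and> eval_rat u w = z} = eval_rat r z"
    by (rule conjugate_fibres[OF q(1) f(1) sqf, of u]) blast
  have lr: "\<And>z. z \<in> Z \<Longrightarrow> card (fib z) = l" "\<And>z. z \<in> Z \<Longrightarrow> \<Prod>(fib z) = eval_rat r z"
    using lr0 by (simp_all add: Z_def fib_def)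
  have "f \<noteq> 0" "q \<noteq> 0" using f q by auto
  then have fin: "finite W" "finite Z" unfolding W_def Z_def by (auto intro!: poly_roots_finite)
  have finfib: "finite (fib z)" for z
    by (rule finite_subset[OF _ fin(1)]) (auto simp: fib_def W_def)
  have card_W: "card W = n"
    using rsquarefree_card_degree[of "complex_of_rat_poly f"] sqf \<open>f \<noteq> 0\<close> f by (simp add: W_def)
  have card_Z: "card Z = degree q"
    using rsquarefree_card_degree[of "complex_of_rat_poly q"] sqq \<open>q \<noteq> 0\<close> by (simp add: Z_def)
  have wZ: "w ^ N \<in> Z" if "w \<in> W" for w
  proof -
    have comp: "eval_rat (q \<circ>\<^sub>p u) v = eval_rat q (v ^ N)" for v
      by (simp add: of_rat_hom.map_poly_pcompose poly_pcompose ev_u)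
    \<comment> \<open>\<open>f\<close> shares the root \<open>x\<close> with q(X^N), so the
      \<open>N\<close>-th power of every root of \<open>f\<close> is a conjugate of \<beta>.\<close>
    have "f dvd q \<circ>\<^sub>p u"
      by (rule irreducible_dvd_if_common_root[OF f(2) xy(1)]) (use q in \<open>simp add: comp \<beta>_def\<close>)
    then obtain K where "q \<circ>\<^sub>p u = f * K" by (rule dvdE)
    then have "eval_rat (q \<circ>\<^sub>p u) w = 0" using that by (simp add: W_def)
    then show ?thesis by (simp add: comp Z_def)
  qed
  have W_eq: "W = (\<Union>z\<in>Z. fib z)" using wZ by (auto simp: fib_def ev_u W_def)
  have disj: "\<forall>z\<in>Z. \<forall>z'\<in>Z. z \<noteq> z' \<longrightarrow> fib z \<inter> fib z' = {}" by (auto simp: fib_def)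
  have "card W = (\<Sum>z\<in>Z. card (fib z))"
    unfolding W_eq using fin finfib disj by (intro card_UN_disjoint) auto
  then have n_eq: "n = degree q * l" using lr(1) card_Z card_W by simp
  have \<beta>Z: "\<beta> \<in> Z" using q by (simp add: Z_def)
  \<comment> \<open>Degeneracy puts two roots into one fibre, so \<open>l \<ge> 2\<close>. As
    \<open>l\<close> divides \<open>n\<close>, it is at least \<open>p\<close>.\<close>
  have "card {x, y} \<le> card (fib \<beta>)"
    using xy y_\<beta> by (intro card_mono finfib) (auto simp: fib_def ev_u \<beta>_def)
  then have l2: "l \<ge> 2" using lr(1)[OF \<beta>Z] xy(3) by simp
  have "degree q > 0" by (rule irreducible_rat_poly_degree_pos[OF q(1)])
  have "degree q = n div l" using n_eq l2 by simp
  also have "\<dots> \<le> n div p" using p l2 n_eq by (intro div_le_mono2) auto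
  finally have deg_q: "degree q \<le> n div p" .
  define \<gamma> where "\<gamma> = eval_rat r \<beta>"
  \<comment> \<open>All \<open>l\<close> members of the fibre have \<open>N\<close>-th power
    \<beta>. The resulting relation makes \<gamma> an algebraic integer and also recovers
    \<open>x\<close> from \<gamma> up to finitely many choices.\<close>
  have "\<gamma> ^ N = (\<Prod>w\<in>fib \<beta>. w ^ N)"
    unfolding \<gamma>_def lr(2)[OF \<beta>Z, symmetric] by (simp add: prod_power_distrib)
  also have "\<dots> = (\<Prod>w\<in>fib \<beta>. \<beta>)" by (intro prod.cong) (auto simp: fib_def ev_u)
  also have "\<dots> = \<beta> ^ l" using lr(1)[OF \<beta>Z] by simp
  finally have \<gamma>N: "x ^ (l * N) = \<gamma> ^ N" by (simp add: \<beta>_def mult.commute flip: power_mult)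
  have "algebraic_int \<gamma>"
  proof (rule algebraic_int_root)
    show "algebraic_int (x ^ (l * N))" by (rule algebraic_int_power[OF alg_x])
    show "poly (monom 1 N) \<gamma> = x ^ (l * N)" by (simp add: poly_monom \<gamma>N)
  qed (use N(1) in \<open>auto simp: degree_monom_eq\<close>)
  then obtain Q where Q: "poly (of_int_poly Q) \<gamma> = 0" "monic Q"
    unfolding algebraic_int_altdef_ipoly by blast
  then have Q': "eval_rat (of_int_poly Q) \<gamma> = 0" "of_int_poly Q \<noteq> (0 :: rat poly)" by auto
  then obtain s where s: "irreducible s" "monic s" "eval_rat s \<gamma> = 0" "\<And>g. eval_rat g \<gamma> = 0 \<Longrightarrow> s dvd g"
    using minimal_rat_poly by metis
  obtain S where S: "monic S" "s = of_int_poly S"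
    using monic_rat_factor_of_int[OF Q(2) s(2) s(4)[OF Q'(1)]] by blast
  have cs: "complex_of_rat_poly s = of_int_poly S" by (simp add: S map_poly_map_poly o_def)
  have sqs: "rsquarefree (complex_of_rat_poly s)" by (rule rsquarefree_irreducible[OF s(1)])
  define G where "G = {g. eval_rat s g = 0}"
  have "s \<noteq> 0" using s by auto
  have card_G: "card G = degree S"
    using rsquarefree_card_degree[of "complex_of_rat_poly s"] sqs \<open>s \<noteq> 0\<close> by (simp add: G_def S)
  \<comment> \<open>Second use: the roots of \<open>q\<close> over the conjugates of \<gamma>. The
    fibre of \<gamma> contains \<beta>, so no fibre is empty, and every conjugate of \<gamma> is the
    value of \<open>r\<close> at some conjugate of \<beta>.\<close>
  obtain k where k0: "\<And>g. eval_rat s g = 0 \<Longrightarrow> card {z. eval_rat q z = 0 \<and> eval_rat r z = g} = k"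
    by (rule conjugate_fibres[OF s(1) q(2) sqq, of r]) blast
  have k: "\<And>g. g \<in> G \<Longrightarrow> card {z. eval_rat q z = 0 \<and> eval_rat r z = g} = k"
    using k0 by (simp add: G_def)
  have fin_r: "finite {z. eval_rat q z = 0 \<and> eval_rat r z = g}" for g
    by (rule finite_subset[OF _ fin(2)]) (auto simp: Z_def)
  have "\<gamma> \<in> G" using s by (simp add: G_def)
  have "card {z. eval_rat q z = 0 \<and> eval_rat r z = \<gamma>} > 0"
    unfolding card_gt_0_iff using fin_r q(3) by (auto simp: \<gamma>_def)
  then have "k > 0" using k[OF \<open>\<gamma> \<in> G\<close>] by simp
  have "\<exists>z\<in>Z. eval_rat r z = g" if "g \<in> G" for g
  proof -
    have "{z. eval_rat q z = 0 \<and> eval_rat r z = g} \<noteq> {}"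
      using k[OF that] \<open>k > 0\<close> by (metis card.empty less_numeral_extra(3))
    then show ?thesis by (auto simp: Z_def)
  qed
  then obtain h where h: "\<And>g. g \<in> G \<Longrightarrow> h g \<in> Z" "\<And>g. g \<in> G \<Longrightarrow> eval_rat r (h g) = g"
    by metis
  have inj: "inj_on h G" by (rule inj_on_inverseI[of _ "eval_rat r"]) (rule h(2))
  have "card G \<le> card Z" using h(1) by (intro card_inj_on_le[OF inj _ fin(2)]) auto
  then have deg_S: "degree S \<le> n div p" using card_G card_Z deg_q by simp
  have "mahler_measure S = (\<Prod>g\<in>G. max 1 (cmod g))"
    unfolding mahler_measure_def cs[symmetric] G_def
    by (rule mahler_measure_poly_rsquarefree[OF sqs]) (use s in simp)
  also have "\<dots> = (\<Prod>g\<in>G. max 1 (cmod (eval_rat r (h g))))" using h by (intro prod.cong) auto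
  also have "\<dots> = (\<Prod>z\<in>h ` G. max 1 (cmod (eval_rat r z)))" using inj by (simp add: prod.reindex)
  \<comment> \<open>The points of \<open>Z\<close> outside the image of \<open>h\<close> contribute
    factors that are at least 1.\<close>
  also have "\<dots> \<le> (\<Prod>z\<in>Z. max 1 (cmod (eval_rat r z)))"
    using h(1) by (intro prod_mono2 fin) auto
  also have "\<dots> \<le> (\<Prod>z\<in>Z. \<Prod>w\<in>fib z. max 1 (cmod w))"
  proof (intro prod_mono conjI)
    fix z assume "z \<in> Z"
    then have "cmod (eval_rat r z) = (\<Prod>w\<in>fib z. cmod w)" 
      unfolding lr(2)[OF \<open>z \<in> Z\<close>, symmetric] by (simp flip: prod_norm)
    also have "\<dots> \<le> (\<Prod>w\<in>fib z. max 1 (cmod w))" by (intro prod_mono) auto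
    finally show "max 1 (cmod (eval_rat r z)) \<le> (\<Prod>w\<in>fib z. max 1 (cmod w))"
      by (intro max.boundedI prod_ge_1) auto
  qed auto
  \<comment> \<open>The fibres partition the roots of \<open>F\<close>.\<close>
  also have "\<dots> = (\<Prod>w\<in>W. max 1 (cmod w))"
    unfolding W_eq using fin finfib disj by (intro prod.UNION_disjoint[symmetric]) auto
  also have "\<dots> = mahler_measure F"
    unfolding mahler_measure_def cf[symmetric] W_def
    by (rule mahler_measure_poly_rsquarefree[OF sqf, symmetric]) (use f in simp)
  finally have M: "mahler_measure S \<le> mahler_measure F" .
  have coeff: "\<bar>real_of_int (coeff S i)\<bar> \<le> 2 ^ degree S * mahler_measure F" for i
    by (rule order.trans[OF coeff_le_mahler_measure mult_left_mono[OF M]]) simp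
  show ?thesis
  proof (rule that)
    show "monic S" "degree S \<le> n div p" by fact+
    show "\<bar>real_of_int (coeff S i)\<bar> \<le> 2 ^ degree S * mahler_measure F" for i by (rule coeff)
    show "poly (of_int_poly S) \<gamma> = 0" using s(3) by (simp add: cs)
    show "poly (of_int_poly F) x = 0" using xy(1) by (simp add: ev_f)
    show "l \<in> {1..n}" using l2 n_eq \<open>degree q > 0\<close> by simp
    show "x ^ (l * N) = \<gamma> ^ N" by (rule \<gamma>N)
  qed
qed

text \<open>It makes the choice of one root for each \<open>F\<close> an injective map.\<close>

lemma monic_irreducible_eq_if_common_root:
  fixes F G :: "int poly"
  assumes "monic F" "irreducible (of_int_poly F :: rat poly)" "poly (of_int_poly F) \<alpha> = (0::complex)"
    and "monic G" "irreducible (of_int_poly G :: rat poly)" "poly (of_int_poly G) \<alpha> = (0::complex)"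
  shows "F = G"
proof -
  have "(of_int_poly F :: rat poly) dvd of_int_poly G" "(of_int_poly G :: rat poly) dvd of_int_poly F"
    using assms by (auto intro!: irreducible_dvd_if_common_root[where z = \<alpha>])
  then have "(of_int_poly F :: rat poly) = of_int_poly G"
    using assms by (intro poly_dvd_antisym) auto
  then show ?thesis by simp
qed

section \<open>Counting the roots that determine the polynomials\<close>

lemma card_UN_le_mult:
  assumes "finite I" "card I \<le> a" "\<And>i. i \<in> I \<Longrightarrow> card (A i) \<le> b"
  shows "card (\<Union>i\<in>I. A i) \<le> a * b"
proof -
  have "card (\<Union>i\<in>I. A i) \<le> (\<Sum>i\<in>I. card (A i))" by (rule card_UN_le[OF assms(1)])
  also have "\<dots> \<le> card I * b" using sum_bounded_above[of I "\<lambda>i. card (A i)" b] assms(3) by simp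
  also have "\<dots> \<le> a * b" using assms(2) by simp
  finally show ?thesis .
qed

lemma finite_power_eq: "m > 0 \<Longrightarrow> finite {z::complex. z ^ m = c}"
  and card_power_eq_le: "m > 0 \<Longrightarrow> card {z::complex. z ^ m = c} \<le> m"
proof -
  assume m: "m > 0"
  let ?p = "monom 1 m + [:- c:]"
  have deg: "degree ?p = m" using m by (subst degree_add_eq_left) (auto simp: degree_monom_eq)
  then have "?p \<noteq> 0" using m by auto
  moreover have "{z. z ^ m = c} = {z. poly ?p z = 0}" by (simp add: poly_monom)
  ultimately show "finite {z::complex. z ^ m = c}" "card {z::complex. z ^ m = c} \<le> m"
    using poly_roots_finite[of ?p] card_poly_roots_bound[of ?p] deg by simp_all
qed

lemma I_n_upper_bound:
  assumes n: "n \<ge> 2" and p: "p > 0" "\<And>l. l \<ge> 2 \<Longrightarrow> l dvd n \<Longrightarrow> p \<le> l"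
  obtains C :: real where "C > 0" "\<And>H. H \<ge> 1 \<Longrightarrow> real (I_n n H) \<le> C * real H ^ (n div p)"
proof -
  obtain N where N: "N > 0"
    "\<And>f x y. f \<noteq> 0 \<Longrightarrow> degree f \<le> n \<Longrightarrow> eval_rat f x = 0 \<Longrightarrow> eval_rat f y = 0 \<Longrightarrow>
      root_of_unity (x / y) \<Longrightarrow> x ^ N = y ^ N"
    by (rule uniform_root_of_unity_exponent[of n]) blast
  \<comment> \<open>\<open>b * H\<close> bounds the coefficients of \<open>S\<close>: its degree is
    at most \<open>n\<close>, and the Mahler measure of \<open>F\<close> is at most
    \<open>(n + 1) * H\<close>.\<close>
  define k b where "k = n div p" and "b = 2 ^ n * (n + 1)"
  \<comment> \<open>The factors count the degrees of \<open>S\<close>, the polynomials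
    \<open>S\<close> of each degree (without the power of \<open>H\<close>), the roots \<gamma> of
    \<open>S\<close>, the exponents \<open>l\<close>, and the solutions \<alpha> of
    \<open>\<alpha> ^ (l * N) = \<gamma> ^ N\<close>.\<close>
  define C where "C = real ((k + 1) * ((3 * b) ^ k * (n * (n * (n * N)))))"
  show ?thesis
  proof (rule that[of C])
    show "C > 0" unfolding C_def of_nat_0_less_iff using n N(1) by (simp add: b_def)
    fix H :: nat assume H: "H \<ge> 1"
    define I where "I = {f \<in> S_n n H. irreducible (map_poly rat_of_int f)}"
    define E where "E S = (\<Union>\<gamma>\<in>{\<gamma>. poly (of_int_poly S) \<gamma> = (0::complex)}.
      \<Union>l\<in>{1..n}. {\<alpha>. \<alpha> ^ (l * N) = \<gamma> ^ N})" for S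
    define A where "A = (\<Union>m\<in>{..k}. \<Union>S\<in>monic_bounded m (b * H). E S)"
    have finS: "finite {\<gamma>. poly (of_int_poly S) \<gamma> = (0::complex)}"
      and cardS: "card {\<gamma>. poly (of_int_poly S) \<gamma> = (0::complex)} \<le> degree S"
      if "S \<in> monic_bounded m B" for S m B
    proof -
      have "S \<noteq> 0" using that by (auto simp: monic_bounded_def)
      then have "of_int_poly S \<noteq> (0 :: complex poly)" by simp
      then show "finite {\<gamma>. poly (of_int_poly S) \<gamma> = (0::complex)}"
        "card {\<gamma>. poly (of_int_poly S) \<gamma> = (0::complex)} \<le> degree S"
        using poly_roots_finite card_poly_roots_bound[of "of_int_poly S :: complex poly"] by auto
    qed
    have finE: "finite (E S)" if "S \<in> monic_bounded m B" for S m B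
      unfolding E_def using N(1) by (intro finite_UN_I finS[OF that] finite_power_eq) auto
    have cardE: "card (E S) \<le> n * (n * (n * N))" if S: "S \<in> monic_bounded m B" "m \<le> k" for S m B
      unfolding E_def
    proof (intro card_UN_le_mult finS[OF S(1)])
      have "degree S = m" using S(1) by (simp add: monic_bounded_def)
      moreover have "k \<le> n" by (simp add: k_def)
      ultimately show "card {\<gamma>. poly (of_int_poly S) \<gamma> = (0::complex)} \<le> n"
        using cardS[OF S(1)] S(2) by linarith
      fix \<gamma> :: complex and l assume l: "l \<in> {1..n}"
      have "card {\<alpha>. \<alpha> ^ (l * N) = \<gamma> ^ N} \<le> l * N" using N(1) l by (intro card_power_eq_le) auto
      also have "\<dots> \<le> n * N" using l by simp
      finally show "card {\<alpha>. \<alpha> ^ (l * N) = \<gamma> ^ N} \<le> n * N" .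
    qed auto
    have finA: "finite A" unfolding A_def
      by (intro finite_UN_I finite_atMost finite_monic_bounded finE)
    have "b > 0" by (simp add: b_def)
    then have "1 \<le> b * H" using H by (simp add: Suc_leI)
    then have base: "2 * (b * H) + 1 \<le> 3 * b * H" by simp
    have "card A \<le> (k + 1) * ((3 * b * H) ^ k * (n * (n * (n * N))))"
      unfolding A_def
    proof (intro card_UN_le_mult finite_monic_bounded cardE)
      fix m assume "m \<in> {..k}"
      then have "m \<le> k" by simp
      have "card (monic_bounded m (b * H)) \<le> (2 * (b * H) + 1) ^ m" by (rule card_monic_bounded)
      also have "\<dots> \<le> (2 * (b * H) + 1) ^ k" using \<open>m \<le> k\<close> by (intro power_increasing) auto
      also have "\<dots> \<le> (3 * b * H) ^ k" by (rule power_mono[OF base]) simp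
      finally show "card (monic_bounded m (b * H)) \<le> (3 * b * H) ^ k" .
    qed auto
    also have "\<dots> = (k + 1) * ((3 * b) ^ k * (n * (n * (n * N)))) * H ^ k"
      by (simp only: power_mult_distrib mult_ac)
    finally have "real (card A) \<le> real ((k + 1) * ((3 * b) ^ k * (n * (n * (n * N)))) * H ^ k)"
      by (simp only: of_nat_le_iff)
    then have cardA: "real (card A) \<le> C * real H ^ k" by (simp add: C_def)
    have "\<exists>\<alpha>\<in>A. poly (of_int_poly F) \<alpha> = 0" if "F \<in> I" for F
    proof -
      have F: "degree F = n" "monic F" "irreducible (of_int_poly F :: rat poly)"
        "degenerate (of_int_poly F)" "\<And>j. j \<in> {1..n} \<Longrightarrow> \<bar>coeff F (n - j)\<bar> \<le> int H"
        using that by (auto simp: I_def S_n_def)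
      have bound: "\<bar>coeff F i\<bar> \<le> int H" for i
      proof -
        consider "i < n" | "i = n" | "i > n" by linarith
        then show ?thesis
        proof cases
          case 1
          then show ?thesis using F(5)[of "n - i"] by simp
        qed (use F H in \<open>auto simp: coeff_eq_0\<close>)
      qed
      have expo: "x ^ N = y ^ N"
        if "poly (of_int_poly F) x = 0" "poly (of_int_poly F) y = 0" "root_of_unity (x / y)" for x y
        by (rule N(2)[of "of_int_poly F"]) (use that F(1,2) in auto)
      obtain S and \<alpha> \<gamma> :: complex and l where S: "monic S" "degree S \<le> n div p"
        "\<And>i. \<bar>real_of_int (coeff S i)\<bar> \<le> 2 ^ degree S * mahler_measure F"
        "poly (of_int_poly S) \<gamma> = 0" "poly (of_int_poly F) \<alpha> = 0"
        "l \<in> {1..n}" "\<alpha> ^ (l * N) = \<gamma> ^ N"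
        by (rule degenerate_resolvent[OF F(2,3,1,4) N(1) expo p]) (assumption | rule that)+
      have "\<bar>coeff S i\<bar> \<le> int (b * H)" for i
      proof -
        have "degree S \<le> n" using S(2) by (meson div_le_dividend le_trans)
        have "\<bar>real_of_int (coeff S i)\<bar> \<le> 2 ^ degree S * mahler_measure F" by (rule S(3))
        also have "\<dots> \<le> 2 ^ n * (real (Suc n) * real H)"
          using \<open>degree S \<le> n\<close> mahler_measure_le[OF bound] mahler_measure_ge_0 F(1)
          by (intro mult_mono) (auto intro: power_increasing)
        also have "\<dots> = real (b * H)" by (simp add: b_def algebra_simps)
        finally show ?thesis by linarith
      qed
      then have "S \<in> monic_bounded (degree S) (b * H)" using S(1) by (simp add: monic_bounded_def)
      then have "\<alpha> \<in> A" using S(2,4,6,7) unfolding A_def E_def k_def by blast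
      then show ?thesis using S(5) by blast
    qed
    then obtain root where root: "\<And>F. F \<in> I \<Longrightarrow> root F \<in> A"
      "\<And>F. F \<in> I \<Longrightarrow> poly (of_int_poly F) (root F) = 0" by metis
    have inj: "inj_on root I"
    proof (rule inj_onI)
      fix F G assume "F \<in> I" "G \<in> I" "root F = root G"
      then show "F = G"
        using root(2)[of F] root(2)[of G]
        by (intro monic_irreducible_eq_if_common_root[of F "root F" G]) (auto simp: I_def S_n_def)
    qed
    have "card I \<le> card A" using root(1) by (intro card_inj_on_le[OF inj _ finA]) auto
    then have "real (card I) \<le> real (card A)" by simp
    then show "real (I_n n H) \<le> C * real H ^ (n div p)"
      using cardA unfolding I_n_def I_def k_def by linarith
  qed
qed

section \<open>Irreducibility criteria\<close>

text \<open>By Gauss's lemma only factorisations into monic integer polynomials have to be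
  excluded.\<close>

lemma irreducible_of_int_polyI:
  fixes F :: "int poly"
  assumes F: "monic F" "degree F > 0"
    and split: "\<And>G K. monic G \<Longrightarrow> monic K \<Longrightarrow> F = G * K \<Longrightarrow> degree G = 0 \<or> degree K = 0"
  shows "irreducible (of_int_poly F :: rat poly)"
proof (rule irreducibleI)
  let ?f = "of_int_poly F :: rat poly"
  show "?f \<noteq> 0" using F by auto
  then show "\<not> ?f dvd 1" using F by (simp add: is_unit_iff_degree)
  fix a b assume ab: "?f = a * b"
  then have nz: "a \<noteq> 0" "b \<noteq> 0" using \<open>?f \<noteq> 0\<close> by auto
  have lead: "lead_coeff a * lead_coeff b = 1"
    using ab F(1) by (metis lead_coeff_mult of_int_hom.hom_lead_coeff of_int_hom.hom_one)
  \<comment> \<open>The two leading coefficients are inverse to each other, so scaling each factor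
    by the other's leading coefficient makes both monic and keeps the product.\<close>
  define a' b' where "a' = smult (lead_coeff b) a" and "b' = smult (lead_coeff a) b"
  have "monic a'" "monic b'" using lead nz by (simp_all add: a'_def b'_def mult.commute)
  moreover have f_eq: "?f = a' * b'" using lead ab by (simp add: a'_def b'_def mult.commute)
  ultimately obtain G K where GK: "monic G" "a' = of_int_poly G" "monic K" "b' = of_int_poly K"
    using monic_rat_factor_of_int[OF F(1), of a'] monic_rat_factor_of_int[OF F(1), of b']
    by (metis dvd_triv_left dvd_triv_right)
  have "of_int_poly F = (of_int_poly (G * K) :: rat poly)"
    using f_eq GK by (simp add: hom_distribs)
  then have "F = G * K" by simp
  then have "degree G = 0 \<or> degree K = 0" by (rule split[OF GK(1,3)])
  moreover have "degree a' = degree a" "degree b' = degree b" using nz by (simp_all add: a'_def b'_def)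
  then have "degree G = degree a" "degree K = degree b" using GK by simp_all
  ultimately show "a dvd 1 \<or> b dvd 1" using nz by (simp add: is_unit_iff_degree)
qed

text \<open>Every other product in the convolution sum has an even factor.\<close>

lemma coeff_mult_odd_at_least_odd:
  fixes G K :: "int poly"
  assumes "odd (coeff G i)" "\<And>a. a < i \<Longrightarrow> even (coeff G a)"
    and "odd (coeff K j)" "\<And>b. b < j \<Longrightarrow> even (coeff K b)"
  shows "odd (coeff (G * K) (i + j))"
proof -
  have "coeff (G * K) (i + j) = (\<Sum>a\<le>i + j. coeff G a * coeff K (i + j - a))"
    by (rule coeff_mult)
  also have "{..i + j} = insert i ({..i + j} - {i})" by auto
  also have "(\<Sum>a\<in>\<dots>. coeff G a * coeff K (i + j - a))
      = coeff G i * coeff K j + (\<Sum>a\<in>{..i + j} - {i}. coeff G a * coeff K (i + j - a))"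
    by (subst sum.insert) auto
  finally have eq: "coeff (G * K) (i + j)
      = coeff G i * coeff K j + (\<Sum>a\<in>{..i + j} - {i}. coeff G a * coeff K (i + j - a))" .
  have "even (\<Sum>a\<in>{..i + j} - {i}. coeff G a * coeff K (i + j - a))"
  proof (rule dvd_sum)
    fix a assume "a \<in> {..i + j} - {i}"
    then consider "a < i" | "i + j - a < j" by fastforce
    then show "even (coeff G a * coeff K (i + j - a))" using assms(2,4) by cases auto
  qed
  then show ?thesis using eq assms(1,3) by simp
qed

text \<open>The lowest odd positions \<open>i\<close> of \<open>G\<close> and \<open>j\<close> of
  \<open>K\<close> give an odd coefficient of \<open>F\<close> at \<open>i + j\<close>, which forces
  \<open>i + j = degree F\<close>. If both factors were nonconstant, both constant coefficients
  would be even and their product divisible by 4.\<close>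

lemma irreducible_eisenstein_2:
  fixes F :: "int poly"
  assumes F: "monic F" "degree F > 0"
    and even: "\<And>i. i < degree F \<Longrightarrow> even (coeff F i)" and "\<not> 4 dvd coeff F 0"
  shows "irreducible (of_int_poly F :: rat poly)"
proof (rule irreducible_of_int_polyI[OF F])
  fix G K :: "int poly" assume GK: "monic G" "monic K" "F = G * K"
  show "degree G = 0 \<or> degree K = 0"
  proof (rule ccontr)
    assume pos: "\<not> (degree G = 0 \<or> degree K = 0)"
    have ex: "odd (coeff G (degree G))" "odd (coeff K (degree K))" using GK by auto
    define i j where "i = (LEAST i. odd (coeff G i))" and "j = (LEAST j. odd (coeff K j))"
    have i: "odd (coeff G i)" "i \<le> degree G" "\<And>a. a < i \<Longrightarrow> even (coeff G a)"
      unfolding i_def using LeastI[of "\<lambda>m. odd (coeff G m)", OF ex(1)]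
        Least_le[of "\<lambda>m. odd (coeff G m)", OF ex(1)] not_less_Least[of _ "\<lambda>m. odd (coeff G m)"]
      by blast+
    have j: "odd (coeff K j)" "j \<le> degree K" "\<And>a. a < j \<Longrightarrow> even (coeff K a)"
      unfolding j_def using LeastI[of "\<lambda>m. odd (coeff K m)", OF ex(2)]
        Least_le[of "\<lambda>m. odd (coeff K m)", OF ex(2)] not_less_Least[of _ "\<lambda>m. odd (coeff K m)"]
      by blast+
    have "odd (coeff F (i + j))"
      unfolding GK(3) using i j by (intro coeff_mult_odd_at_least_odd) auto
    then have "\<not> i + j < degree F" using even by blast
    moreover have "G \<noteq> 0" "K \<noteq> 0" using GK by auto
    then have "degree F = degree G + degree K" by (simp add: GK(3) degree_mult_eq)
    ultimately have "i > 0" "j > 0" using i(2) j(2) pos by auto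
    then have "2 * 2 dvd coeff G 0 * coeff K 0" using i(3) j(3) by (intro mult_dvd_mono) auto
    then show False using \<open>\<not> 4 dvd coeff F 0\<close> by (simp add: GK(3) coeff_mult)
  qed
qed

text \<open>\<open>f\<close> is a polynomial in X^k, so multiplication by a primitive
  \<open>k\<close>-th root of unity maps roots to roots, and it moves any nonzero root.\<close>

lemma degenerateI_rotation:
  fixes f :: "complex poly"
  assumes k: "k \<ge> 2" and f: "degree f > 0" "coeff f 0 \<noteq> 0"
    and supp: "\<And>i. coeff f i \<noteq> 0 \<Longrightarrow> k dvd i"
  shows "degenerate f"
proof -
  have "\<not> constant (poly f)" using f(1) by (simp add: constant_degree)
  then obtain x where x: "poly f x = 0" using fundamental_theorem_of_algebra by blast
  have "x \<noteq> 0" using x f(2) by (auto simp: poly_0_coeff_0)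
  define \<omega> where "\<omega> = cis (2 * pi / k)"
  have \<omega>k: "\<omega> ^ k = 1" using k by (simp add: \<omega>_def DeMoivre)
  have "\<omega> \<noteq> 1"
  proof
    assume "\<omega> = 1"
    then have "cos (2 * pi / k) = 1" by (simp add: \<omega>_def complex_eq_iff)
    moreover have "cos (2 * pi / k) < cos 0"
      using k by (intro cos_monotone_0_pi) (auto simp: field_simps)
    ultimately show False by simp
  qed
  have "poly f (\<omega> * x) = poly f x"
    unfolding poly_altdef
  proof (intro sum.cong refl)
    fix i
    show "coeff f i * (\<omega> * x) ^ i = coeff f i * x ^ i"
    proof (cases "coeff f i = 0")
      case False
      then obtain m where "i = k * m" using supp by blast
      then have "\<omega> ^ i = 1" by (simp add: power_mult \<omega>k)
      then show ?thesis by (simp add: power_mult_distrib)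
    qed simp
  qed
  moreover have "root_of_unity (\<omega> * x / x)"
    unfolding root_of_unity_def using k \<omega>k \<open>x \<noteq> 0\<close> by (intro exI[of _ k]) simp
  moreover have "\<omega> * x \<noteq> x" using \<open>\<omega> \<noteq> 1\<close> \<open>x \<noteq> 0\<close> by simp
  ultimately show ?thesis unfolding degenerate_def using x by metis
qed

text \<open>This is the constant term of A(X) A(1/X). Over the integers, a small sum of squares
  leaves only few and small coefficients.\<close>

lemma coeff_mult_reflect_poly:
  assumes "degree A = n" "coeff A 0 \<noteq> 0"
  shows "coeff (A * reflect_poly A) n = (\<Sum>i\<le>n. coeff A i * coeff A i)"
  unfolding coeff_mult by (intro sum.cong refl) (auto simp: coeff_reflect_poly assms)

text \<open>Of the nine products of monomials only X^n X^(n-j) and X^j X^n have degree strictly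
  between n and 2n; these positions reveal \<open>j\<close>.\<close>

lemma coeff_trinomial_mult_reflection:
  fixes e d :: int
  assumes "0 < j" "j < n" "0 < s" "s < n"
  shows "coeff ((monom e n + monom d j + monom (- e) 0) * (monom (- e) n + monom d (n - j) + monom e 0)) (n + s)
    = e * d * ((if s = n - j then 1 else 0) - (if s = j then 1 else 0))"
proof -
  have "n + n \<noteq> n + s" "n + (n - j) = n + s \<longleftrightarrow> s = n - j" "n + 0 \<noteq> n + s" "j + n = n + s \<longleftrightarrow> s = j"
    "j + (n - j) \<noteq> n + s" "j + 0 \<noteq> n + s" "0 + n \<noteq> n + s" "0 + (n - j) \<noteq> n + s" "0 + 0 \<noteq> n + s"
    using assms by linarith+
  then show ?thesis
    by (simp only: distrib_left distrib_right mult_monom coeff_add coeff_monom) simp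
qed

lemma reflect_poly_trinomial:
  fixes e d c :: "'a :: comm_ring_1"
  assumes j: "0 < j" "j < n" and e: "e \<noteq> 0"
  shows "reflect_poly (monom e n + monom d j + monom c 0) = monom c n + monom d (n - j) + monom e 0"
proof (rule poly_eqI)
  fix i
  define A where "A = monom e n + monom d j + monom c 0"
  have cA: "coeff A m = (if m = n then e else if m = j then d else if m = 0 then c else 0)" for m
    using j by (simp add: A_def)
  have "degree A = n"
  proof (intro antisym degree_le le_degree allI impI)
    show "coeff A m = 0" if "n < m" for m unfolding cA using that j by simp
    show "coeff A n \<noteq> 0" unfolding cA using e by simp
  qed
  moreover have "n - i = n \<longleftrightarrow> i = 0" "n - i = j \<longleftrightarrow> i = n - j" "n - i = 0 \<longleftrightarrow> i = n" if "i \<le> n"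
    using that j by linarith+
  ultimately have "coeff (reflect_poly A) i
      = (if n < i then 0 else if i = 0 then e else if i = n - j then d else if i = n then c else 0)"
    unfolding coeff_reflect_poly cA by simp
  then show "coeff (reflect_poly (monom e n + monom d j + monom c 0)) i
      = coeff (monom c n + monom d (n - j) + monom e 0) i"
    unfolding coeff_add coeff_monom A_def[symmetric] using j
    by (cases "i = n"; cases "i = n - j") simp_all
qed

text \<open>Integer squares skip 2 and 3, so both end terms are 1 and the interior contributes
  exactly 1, from a single index.\<close>

lemma sum_squares_eq_3:
  fixes a :: "nat \<Rightarrow> int"
  assumes "(\<Sum>i\<le>n. a i * a i) = 3" "a 0 \<noteq> 0" "a n \<noteq> 0" "n > 0"
  obtains j where "0 < j" "j < n" "\<And>i. i \<le> n \<Longrightarrow> i \<noteq> 0 \<Longrightarrow> i \<noteq> n \<Longrightarrow> i \<noteq> j \<Longrightarrow> a i = 0"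
    "\<bar>a 0\<bar> = 1" "\<bar>a n\<bar> = 1" "\<bar>a j\<bar> = 1"
proof -
  have sq: "1 \<le> x * x" if "x \<noteq> 0" for x :: int
    using that by (metis int_one_le_iff_zero_less linorder_not_less mult_eq_0_iff order_antisym_conv zero_le_square)
  have sq_abs: "\<bar>x\<bar> = 1" if "x * x < 4" "x \<noteq> 0" for x :: int
  proof (rule ccontr)
    assume "\<bar>x\<bar> \<noteq> 1"
    then have "2 * 2 \<le> \<bar>x\<bar> * \<bar>x\<bar>" using that(2) by (intro mult_mono) auto
    then show False using that(1) by simp
  qed
  have "{..n} = insert 0 (insert n {0<..<n})" using assms(4) by auto
  then have s: "a 0 * a 0 + (a n * a n + (\<Sum>i\<in>{0<..<n}. a i * a i)) = 3"
    using assms(1,4) by simp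
  let ?S = "\<Sum>i\<in>{0<..<n}. a i * a i"
  have S0: "?S \<ge> 0" by (intro sum_nonneg) auto
  have not4: "x * x \<noteq> 2" "x * x \<noteq> 3" for x :: int
  proof -
    have "x * x \<noteq> 2 \<and> x * x \<noteq> 3"
    proof (cases "\<bar>x\<bar> \<le> 1")
      case True then have "x = -1 \<or> x = 0 \<or> x = 1" by linarith
      then show ?thesis by auto
    next
      case False
      then have "2 * 2 \<le> \<bar>x\<bar> * \<bar>x\<bar>" by (intro mult_mono) auto
      then show ?thesis by auto
    qed
    then show "x * x \<noteq> 2" "x * x \<noteq> 3" by auto
  qed
  have a0: "a 0 * a 0 = 1" and an: "a n * a n = 1" and S: "?S = 1"
    using s S0 sq[OF assms(2)] sq[OF assms(3)] not4[of "a 0"] not4[of "a n"] by linarith+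
  have "\<exists>j\<in>{0<..<n}. a j * a j \<noteq> 0"
    using S by (metis (no_types, lifting) sum.neutral zero_neq_one)
  then obtain j where j: "j \<in> {0<..<n}" "a j \<noteq> 0" by auto
  have "?S = a j * a j + (\<Sum>i\<in>{0<..<n} - {j}. a i * a i)" by (rule sum.remove) (use j in auto)
  moreover have "(\<Sum>i\<in>{0<..<n} - {j}. a i * a i) \<ge> 0" by (intro sum_nonneg) auto
  ultimately have aj: "a j * a j = 1" and rest: "(\<Sum>i\<in>{0<..<n} - {j}. a i * a i) = 0"
    using S sq[OF j(2)] by linarith+
  have zero: "a i = 0" if "i \<in> {0<..<n} - {j}" for i
  proof -
    have "\<forall>i\<in>{0<..<n} - {j}. a i * a i = 0"
      using rest by (subst (asm) sum_nonneg_eq_0_iff) auto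
    then show ?thesis using that by auto
  qed
  show ?thesis
  proof (rule that[of j])
    show "0 < j" "j < n" using j by auto
    show "\<bar>a 0\<bar> = 1" using a0 assms(2) by (intro sq_abs) auto
    show "\<bar>a n\<bar> = 1" using an assms(3) by (intro sq_abs) auto
    show "\<bar>a j\<bar> = 1" using aj j by (intro sq_abs) auto
    show "a i = 0" if "i \<le> n" "i \<noteq> 0" "i \<noteq> n" "i \<noteq> j" for i using that by (intro zero) auto
  qed
qed

section \<open>Irreducibility of X^n - X^k - 1 when k divides n\<close>

context
  fixes n k :: nat and F :: "int poly"
  assumes k: "0 < k" "k < n" and F: "F = monom 1 n - monom 1 k - 1"
begin

lemma trinomial_monoms: "F = monom 1 n + monom (- 1) k + monom (- 1) 0"
  by (rule poly_eqI) (auto simp: F)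

lemma coeff_trinomial: "coeff F i = (if i = n then 1 else if i = k \<or> i = 0 then - 1 else 0)"
  using k by (auto simp: trinomial_monoms)

lemma degree_trinomial: "degree F = n"
  using coeff_trinomial k by (intro antisym degree_le le_degree) auto

lemma reflect_trinomial: "reflect_poly F = monom (- 1) n + monom (- 1) (n - k) + monom 1 0"
  unfolding trinomial_monoms by (rule reflect_poly_trinomial[OF k]) simp

text \<open>The common product determines \<open>A\<close>: its middle coefficient leaves three
  coefficients 1 or -1, its top coefficient makes the two outer ones opposite, and the coefficients
  in between locate the inner exponent and its sign.\<close>

lemma trinomial_eq_if_mult_reflect_poly_eq:
  assumes A: "degree A = n" "coeff A 0 \<noteq> 0" "A * reflect_poly A = F * reflect_poly F"
  shows "A \<in> {F, - F, reflect_poly F, - reflect_poly F}"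
proof -
  have "(\<Sum>i\<le>n. coeff A i * coeff A i) = (\<Sum>i\<le>n. coeff F i * coeff F i)"
    using coeff_mult_reflect_poly[OF A(1,2)] coeff_mult_reflect_poly[OF degree_trinomial] A(3) k
    by (simp add: coeff_trinomial)
  also have "\<dots> = (\<Sum>i\<in>{0, k, n}. coeff F i * coeff F i)"
    using k by (intro sum.mono_neutral_right) (auto simp: coeff_trinomial)
  also have "\<dots> = 3" using k by (simp add: coeff_trinomial)
  finally have sum3: "(\<Sum>i\<le>n. coeff A i * coeff A i) = 3" .
  have "coeff A n \<noteq> 0" using A(1,2) by (metis coeff_0 leading_coeff_0_iff)
  then obtain j where j: "0 < j" "j < n"
    "\<And>i. i \<le> n \<Longrightarrow> i \<noteq> 0 \<Longrightarrow> i \<noteq> n \<Longrightarrow> i \<noteq> j \<Longrightarrow> coeff A i = 0"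
    "\<bar>coeff A 0\<bar> = 1" "\<bar>coeff A n\<bar> = 1" "\<bar>coeff A j\<bar> = 1"
    using sum_squares_eq_3[OF sum3 A(2)] k by auto
  define e d where "e = coeff A n" and "d = coeff A j"
  have ed: "e = 1 \<or> e = - 1" "d = 1 \<or> d = - 1" using j(5,6) unfolding e_def d_def by linarith+
  have "coeff (A * reflect_poly A) (n + n) = coeff A n * coeff A 0"
    using coeff_mult_degree_sum[of A "reflect_poly A"] A(1,2) by (simp add: coeff_reflect_poly)
  moreover have "coeff (F * reflect_poly F) (n + n) = coeff F n * coeff F 0"
    using coeff_mult_degree_sum[of F "reflect_poly F"] k degree_trinomial
    by (simp add: coeff_reflect_poly coeff_trinomial)
  ultimately have "e * coeff A 0 = - 1" using A(3) k by (simp add: coeff_trinomial e_def)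
  then have A0: "coeff A 0 = - e" using ed(1) by auto
  have A_eq: "A = monom e n + monom d j + monom (- e) 0"
  proof (rule poly_eqI)
    fix i
    show "coeff A i = coeff (monom e n + monom d j + monom (- e) 0) i"
      using j(1,2) j(3)[of i] A0 A(1) by (cases "i \<le> n") (auto simp: e_def d_def coeff_eq_0)
  qed
  have reflect_A: "reflect_poly A = monom (- e) n + monom d (n - j) + monom e 0"
    by (subst A_eq) (rule reflect_poly_trinomial[OF j(1,2)], use ed(1) in auto)
  have key: "e * d * ((if s = n - j then 1 else 0) - (if s = j then 1 else 0))
      = (if s = k then 1 else 0) - (if s = n - k then 1 else 0)" if "0 < s" "s < n" for s
  proof -
    have "coeff (A * reflect_poly A) (n + s)
        = e * d * ((if s = n - j then 1 else 0) - (if s = j then 1 else 0))"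
      unfolding reflect_A by (subst A_eq) (rule coeff_trinomial_mult_reflection[OF j(1,2) that])
    moreover have "coeff (F * reflect_poly F) (n + s)
        = 1 * (- 1) * ((if s = n - k then 1 else 0) - (if s = k then 1 else 0))"
      unfolding reflect_trinomial
      using coeff_trinomial_mult_reflection[OF k that, of 1 "- 1"] by (simp add: trinomial_monoms)
    ultimately show ?thesis using A(3) by auto
  qed
  have "j = k \<and> d = - e \<or> j = n - k \<and> d = e"
  proof (cases "k = n - k")
    \<comment> \<open>The right side of \<open>key\<close> vanishes identically here, so
      \<open>j\<close> is the midpoint as well, and either sign of \<open>d\<close> is
      allowed.\<close>
    case True
    then have "(if j = k then 1 else 0) = (if j = n - k then 1 else (0 :: int))" by presburger
    then have "e * d * ((if j = n - j then 1 else 0) - 1) = 0" using key[OF j(1,2)] by simp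
    then have "j = n - j" using ed by (auto split: if_splits)
    then have "j = k" "j = n - k" using True j(2) k by linarith+
    then show ?thesis using ed by auto
  next
    case False
    then have "e * d * ((if k = n - j then 1 else 0) - (if k = j then 1 else 0)) = 1"
      using key[OF k] by simp
    then consider "k = n - j" "e * d = 1" | "k = j" "e * d = - 1" by (auto split: if_splits)
    then show ?thesis
    proof cases
      case 1
      then have "j = n - k" "d = e" using ed j(2) by auto
      then show ?thesis by blast
    next
      case 2
      then have "j = k" "d = - e" using ed by auto
      then show ?thesis by blast
    qed
  qed
  then show ?thesis
  proof (elim disjE conjE)
    assume "j = k" "d = - e"
    then have "A = smult e F"
      by (subst A_eq) (simp only: trinomial_monoms smult_add_right smult_monom mult_minus_right mult_1_right)
    then show ?thesis using ed(1) by auto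
  next
    assume "j = n - k" "d = e"
    then have "A = smult (- e) (reflect_poly F)"
      by (subst A_eq) (simp only: reflect_trinomial smult_add_right smult_monom mult_minus_right
          minus_minus mult_1_right)
    then show ?thesis using ed(1) by auto
  qed
qed

text \<open>For \<open>w = z ^ k\<close> the two equations give \<open>w * w + w + 1 = 0\<close>,
  hence \<open>w ^ 3 = 1\<close>. As \<open>k\<close> divides \<open>n\<close>, \<open>w + 1\<close>
  is a power of \<open>w\<close> and its cube is 1, whereas the quadratic relation makes that cube
  -1.\<close>

lemma trinomial_no_reciprocal_root:
  fixes z :: complex
  assumes "k dvd n" "z \<noteq> 0" "poly (of_int_poly F) z = 0" "poly (of_int_poly F) (inverse z) = 0"
  shows False
proof -
  define w where "w = z ^ k"
  have ev: "poly (of_int_poly F) x = x ^ n - x ^ k - 1" for x :: complex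
    by (simp add: F hom_distribs poly_monom)
  have zn: "z ^ n = w + 1" using assms(3) by (simp add: ev w_def algebra_simps)
  have "w \<noteq> 0" using assms(2) by (simp add: w_def)
  have "inverse (w + 1) - inverse w - 1 = 0"
    using assms(4) unfolding ev power_inverse zn by (simp add: w_def)
  moreover have "w + 1 \<noteq> 0" unfolding zn[symmetric] using assms(2) by simp
  ultimately have w2: "w * w + w + 1 = 0"
    using \<open>w \<noteq> 0\<close> by (simp add: field_simps)
  obtain m where "n = k * m" using assms(1) by blast
  then have "w + 1 = w ^ m" using zn by (simp add: w_def power_mult)
  then have "(w + 1) ^ 3 = (w ^ 3) ^ m" by (simp add: mult.commute flip: power_mult)
  also have "w ^ 3 = 1 + (w - 1) * (w * w + w + 1)" by (simp add: algebra_simps power3_eq_cube)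
  finally have cube: "(w + 1) ^ 3 = 1" unfolding w2 by simp
  have "(w + 1) ^ 3 = (w + 2) * (w * w + w + 1) - 1"
    by (simp add: algebra_simps power3_eq_cube)
  then show False unfolding w2 cube by simp
qed

lemma trinomial_irreducible:
  assumes "k dvd n"
  shows "irreducible (of_int_poly F :: rat poly)"
proof (rule irreducible_of_int_polyI)
  show "monic F" "degree F > 0" using k by (simp_all add: degree_trinomial coeff_trinomial)
  fix G K :: "int poly" assume GK: "monic G" "monic K" "F = G * K"
  have nz: "G \<noteq> 0" "K \<noteq> 0" using GK by auto
  have "coeff G 0 * coeff K 0 = - 1" using coeff_trinomial[of 0] k by (simp add: GK(3) coeff_mult)
  then have nz0: "coeff G 0 \<noteq> 0" "coeff K 0 \<noteq> 0" by auto
  text \<open>Ljunggren's device: exchanging \<open>K\<close> for its reciprocal changes \<open>F\<close> into a polynomial \<open>A\<close> with the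
    same \<open>A(X) A(1/X)\<close>, hence with three coefficients \<open>1\<close> or \<open>-1\<close>; this forces \<open>A\<close> to be \<open>F\<close>
    or its reciprocal up to sign, so that \<open>G\<close> or \<open>K\<close> is self-reciprocal up to sign.\<close>
  define A where "A = G * reflect_poly K"
  have "degree A = n"
    using nz nz0 degree_trinomial unfolding A_def GK(3)
    by (simp add: degree_mult_eq)
  moreover have "coeff A 0 \<noteq> 0" using nz nz0 by (simp add: A_def coeff_mult)
  moreover have "A * reflect_poly A = F * reflect_poly F"
    using nz0 by (simp add: A_def GK(3) reflect_poly_mult mult_ac)
  ultimately have "A \<in> {F, - F, reflect_poly F, - reflect_poly F}"
    by (rule trinomial_eq_if_mult_reflect_poly_eq)
  moreover have "reflect_poly K \<in> {K, - K}" if "A \<in> {F, - F}"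
  proof -
    have "G * reflect_poly K = G * K \<or> G * reflect_poly K = G * (- K)"
      using that by (auto simp: A_def GK(3))
    then show ?thesis unfolding mult_left_cancel[OF nz(1)] by simp
  qed
  moreover have "reflect_poly G \<in> {G, - G}" if "A \<in> {reflect_poly F, - reflect_poly F}"
  proof -
    have "G * reflect_poly K = reflect_poly G * reflect_poly K
        \<or> G * reflect_poly K = (- reflect_poly G) * reflect_poly K"
      using that by (auto simp: A_def GK(3) reflect_poly_mult)
    then have "G = reflect_poly G \<or> G = - reflect_poly G"
      using nz(2) by (simp only: mult_cancel_right reflect_poly_eq_0_iff) auto
    then show ?thesis by auto
  qed
  ultimately have self: "reflect_poly K \<in> {K, - K} \<or> reflect_poly G \<in> {G, - G}" by blast
  \<comment> \<open>The roots of a factor that is self-reciprocal up to sign are closed under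
    inversion, and \<open>F\<close> has no such pair of roots.\<close>
  have "degree L = 0" if L: "reflect_poly L \<in> {L, - L}" "L dvd F" "coeff L 0 \<noteq> 0" for L
  proof (rule ccontr)
    assume "degree L \<noteq> 0"
    let ?L = "of_int_poly L :: complex poly"
    have "\<not> constant (poly ?L)" using \<open>degree L \<noteq> 0\<close> by (simp add: constant_degree)
    then obtain z where z: "poly ?L z = 0" using fundamental_theorem_of_algebra by blast
    have "z \<noteq> 0" using z L(3) by (auto simp: poly_0_coeff_0)
    have "reflect_poly ?L = of_int_poly (reflect_poly L)"
      by (rule poly_eqI) (simp add: coeff_reflect_poly)
    then have "reflect_poly ?L \<in> {?L, - ?L}" using L(1) by (auto simp: hom_distribs)
    then have "poly (reflect_poly ?L) z = 0" using z by auto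
    then have z': "poly ?L (inverse z) = 0" using \<open>z \<noteq> 0\<close> by (simp add: poly_reflect_poly_nz)
    obtain M where "F = L * M" using L(2) by blast
    then have "poly (of_int_poly F) z = 0" "poly (of_int_poly F) (inverse z) = 0"
      using z z' by (simp_all add: hom_distribs)
    then show False by (rule trinomial_no_reciprocal_root[OF assms \<open>z \<noteq> 0\<close>])
  qed
  then show "degree G = 0 \<or> degree K = 0" using self nz0 GK(3) by auto
qed

end

section \<open>The lower bound\<close>

text \<open>The comparison covers composite divisors too, because fibre sizes can be
  composite.\<close>

lemma least_prime_divisor:
  fixes n :: nat
  assumes "n \<ge> 2" "p = (LEAST q. prime q \<and> q dvd n)"
  shows "prime p" "p dvd n" "\<And>l. l \<ge> 2 \<Longrightarrow> l dvd n \<Longrightarrow> p \<le> l"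
proof -
  have "\<exists>q. prime q \<and> q dvd n" using assms(1) by (intro prime_factor_nat) auto
  then have "prime p \<and> p dvd n" unfolding assms(2) by (rule LeastI_ex)
  then show "prime p" "p dvd n" by auto
  fix l assume l: "l \<ge> 2" "l dvd n"
  then obtain q where q: "prime q" "q dvd l" using prime_factor_nat[of l] by auto
  then have "p \<le> q" unfolding assms(2) using l(2) by (intro Least_le) (auto intro: dvd_trans)
  also have "q \<le> l" using q(2) l(1) by (intro dvd_imp_le) auto
  finally show "p \<le> l" .
qed

lemma finite_irreducible_S_n: "finite {f \<in> S_n n H. irreducible (map_poly rat_of_int f)}"
  using finite_S_n by (rule rev_finite_subset) auto

text \<open>The family consists of the monic polynomials in X^p whose lower coefficients are
  congruent to 2 modulo 4 and lie between 2 and \<open>H\<close>. Each is Eisenstein at 2, and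
  rotation by a \<open>p\<close>-th root of unity makes it degenerate.\<close>

lemma I_n_lower_bound:
  assumes p: "p \<ge> 2" "p dvd n" and H: "H \<ge> 2" and n: "n > 0"
  shows "((H + 2) div 4) ^ (n div p) \<le> I_n n H"
proof -
  define m where "m = n div p"
  have nm: "n = p * m" using p by (simp add: m_def)
  then have m: "m > 0" using n by simp
  \<comment> \<open>Each \<open>b i\<close> encodes the coefficient \<open>4 * b i + 2\<close>,
    which is at most \<open>H\<close> exactly when \<open>b i < (H + 2) div 4\<close>. Extensional
    functions keep the encoding injective.\<close>
  define B where "B = {..<m} \<rightarrow>\<^sub>E {..<(H + 2) div 4}"
  define f :: "(nat \<Rightarrow> nat) \<Rightarrow> int poly" where
    "f b = monom 1 n + (\<Sum>i<m. monom (int (4 * b i + 2)) (p * i))" for b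
  have co: "coeff (f b) (p * i) = int (4 * b i + 2)" if "i < m" for b i
  proof -
    have "coeff (f b) (p * i) = (\<Sum>k<m. if k = i then int (4 * b k + 2) else 0)"
      using that p(1) by (simp add: f_def nm coeff_sum cong: if_cong)
    then show ?thesis using that by (simp add: sum.delta)
  qed
  have con: "coeff (f b) n = 1" for b
    using p(1) by (simp add: f_def nm coeff_sum)
  have co0: "coeff (f b) i = 0" if "i \<noteq> n" "\<And>k. k < m \<Longrightarrow> i \<noteq> p * k" for b i
  proof -
    have "coeff (f b) i = (\<Sum>k<m. coeff (monom (int (4 * b k + 2)) (p * k)) i)"
      using that(1) by (simp add: f_def coeff_sum)
    also have "\<dots> = 0"
    proof (rule sum.neutral, rule ballI)
      fix k assume "k \<in> {..<m}"
      then have "p * k \<noteq> i" using that(2)[of k] by auto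
      then show "coeff (monom (int (4 * b k + 2)) (p * k)) i = 0" by simp
    qed
    finally show ?thesis .
  qed
  have cases: "(\<exists>k<m. i = p * k) \<or> i = n \<or> coeff (f b) i = 0" for b i
    using co0[of i b] by blast
  have deg: "degree (f b) = n" for b
  proof (rule antisym)
    have "coeff (f b) i = 0" if "n < i" for i
    proof (rule co0)
      show "i \<noteq> n" using that by simp
      fix k assume "k < m"
      then have "p * k \<le> n" by (simp add: nm)
      then show "i \<noteq> p * k" using that by simp
    qed
    then show "degree (f b) \<le> n" by (intro degree_le) simp
    show "n \<le> degree (f b)" by (rule le_degree) (simp add: con)
  qed
  have monic: "monic (f b)" for b by (simp add: deg con)
  have const: "coeff (f b) 0 = int (4 * b 0 + 2)" for b using co[OF m, of b] by simp
  have inj: "inj_on f B"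
  proof (rule inj_onI)
    fix b b' assume b: "b \<in> B" "b' \<in> B" "f b = f b'"
    show "b = b'"
    proof (rule PiE_ext[OF b(1,2)[unfolded B_def]])
      fix i assume "i \<in> {..<m}"
      then show "b i = b' i" using co[of i b] co[of i b'] b(3) by simp
    qed
  qed
  have sub: "f ` B \<subseteq> {f \<in> S_n n H. irreducible (map_poly rat_of_int f)}"
  proof (intro image_subsetI CollectI conjI)
    fix b assume b: "b \<in> B"
    have not4: "\<not> 4 dvd coeff (f b) 0" unfolding const by presburger
    show "irreducible (map_poly rat_of_int (f b))"
    proof (rule irreducible_eisenstein_2[OF monic _ _ not4])
      show "degree (f b) > 0" using n by (simp add: deg)
      fix i assume "i < degree (f b)"
      then show "even (coeff (f b) i)" using cases[of i b] co[of _ b] by (auto simp: deg)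
    qed
    have bound: "\<bar>coeff (f b) i\<bar> \<le> int H" if "i \<noteq> n" for i
    proof -
      have "\<bar>int (4 * b k + 2)\<bar> \<le> int H" if "k < m" for k
      proof -
        have "b k < (H + 2) div 4" using b that by (auto simp: B_def)
        then show ?thesis by linarith
      qed
      then show ?thesis using cases[of i b] co[of _ b] that by auto
    qed
    have degen: "degenerate (of_int_poly (f b))"
    proof (rule degenerateI_rotation[OF p(1)])
      show "degree (of_int_poly (f b) :: complex poly) > 0" using n by (simp add: deg)
      show "coeff (of_int_poly (f b) :: complex poly) 0 \<noteq> 0"
        unfolding of_int_hom.coeff_map_poly_hom const of_int_eq_0_iff by simp
      show "p dvd i" if "coeff (of_int_poly (f b) :: complex poly) i \<noteq> 0" for i
        using cases[of i b] that nm by auto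
    qed
    show "f b \<in> S_n n H"
      unfolding S_n_def using monic degen n by (auto simp: deg intro!: bound)
  qed
  have "card B = ((H + 2) div 4) ^ m" by (simp add: B_def card_PiE)
  moreover have "card B \<le> I_n n H"
    unfolding I_n_def by (rule card_inj_on_le[OF inj sub finite_irreducible_S_n])
  ultimately show ?thesis by (simp add: m_def)
qed

text \<open>This settles \<open>n = 2\<close>, which has no divisor strictly between 1 and
  \<open>n\<close> for a trinomial.\<close>

lemma X2_plus_1_mem_S_n: "monom 1 2 + 1 \<in> S_n 2 1"
  and irreducible_X2_plus_1: "irreducible (of_int_poly (monom 1 2 + 1) :: rat poly)"
proof -
  define f where "f = (monom 1 2 + 1 :: int poly)"
  have co: "coeff f i = (if i = 2 \<or> i = 0 then 1 else 0)" for i by (simp add: f_def)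
  have deg: "degree f = 2" using co by (intro antisym degree_le le_degree) auto
  have ev: "poly (of_int_poly f) x = x ^ 2 + 1" for x :: complex
    by (simp add: f_def hom_distribs poly_monom)
  have "degenerate (of_int_poly f)"
    by (rule degenerateI_rotation[of 2]) (auto simp: deg co split: if_splits)
  then show "monom 1 2 + 1 \<in> S_n 2 1"
    unfolding f_def[symmetric] by (auto simp: S_n_def deg co)
  show "irreducible (of_int_poly (monom 1 2 + 1) :: rat poly)"
    unfolding f_def[symmetric]
  proof (rule irreducible_of_int_polyI)
    show "monic f" "degree f > 0" by (simp_all add: deg co)
    fix G K assume GK: "monic G" "monic K" "f = G * K"
    show "degree G = 0 \<or> degree K = 0"
    proof (rule ccontr)
      assume "\<not> (degree G = 0 \<or> degree K = 0)"
      moreover have "G \<noteq> 0" "K \<noteq> 0" using GK by auto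
      then have "degree G + degree K = 2" using deg by (simp add: GK(3) degree_mult_eq)
      ultimately have "degree G = 1" by linarith
      define a where "a = coeff G 0"
      have "G = [:a, 1:]"
      proof (rule poly_eqI)
        fix i :: nat
        consider "i = 0" | "i = 1" | "i > 1" by linarith
        then show "coeff G i = coeff [:a, 1:] i"
          by cases (use \<open>degree G = 1\<close> GK(1) in \<open>auto simp: a_def coeff_pCons coeff_eq_0 split: nat.split\<close>)
      qed
      then have "poly f (- a) = 0" by (simp add: GK(3))
      then have "a ^ 2 + 1 = 0" by (simp add: f_def poly_monom)
      moreover have "a ^ 2 \<ge> 0" by simp
      ultimately show False by linarith
    qed
  qed
qed

text \<open>All exponents are multiples of \<open>k > 1\<close>, so the rotation criterion
  applies.\<close>

lemma trinomial_mem_S_n: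
  assumes k: "1 < k" "k < n" "k dvd n"
  shows "monom 1 n - monom 1 k - 1 \<in> S_n n 1"
proof -
  define F where "F = (monom 1 n - monom 1 k - 1 :: int poly)"
  have k0: "0 < k" using k by simp
  note co = coeff_trinomial[OF k0 k(2) F_def] and deg = degree_trinomial[OF k0 k(2) F_def]
  have "degenerate (of_int_poly F)"
    by (rule degenerateI_rotation[of k]) (use k in \<open>auto simp: deg co split: if_splits\<close>)
  then show ?thesis
    unfolding F_def[symmetric] S_n_def using k by (auto simp: deg co)
qed

lemma I_n_1_pos:
  assumes n: "n \<ge> 2" and odd: "\<not> (prime n \<and> odd n)"
  shows "I_n n 1 \<ge> 1"
proof -
  have "\<exists>f \<in> S_n n 1. irreducible (map_poly rat_of_int f)"
  proof (cases "n = 2")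
    case True
    then show ?thesis using X2_plus_1_mem_S_n irreducible_X2_plus_1 by blast
  next
    case False
    have "\<not> prime n" using odd n False by (metis even_iff_mod_2_eq_zero primes_dvd_imp_eq two_is_prime_nat dvd_eq_mod_eq_0)
    then obtain k where k: "k dvd n" "k \<noteq> 1" "k \<noteq> n" using n by (auto simp: prime_nat_iff)
    have "k \<le> n" using k(1) n by (intro dvd_imp_le) auto
    moreover have "k \<noteq> 0" using k(1) n by (cases "k = 0") auto
    ultimately have "1 < k" "k < n" using k by auto
    then show ?thesis
      using trinomial_mem_S_n[of k n] trinomial_irreducible[of k n, OF _ _ refl] k(1)
      by (intro bexI[of _ "monom 1 n - monom 1 k - 1"]) auto
  qed
  then have "{f \<in> S_n n 1. irreducible (map_poly rat_of_int f)} \<noteq> {}" by blast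
  then show ?thesis
    unfolding I_n_def using finite_irreducible_S_n[of n 1] by (simp add: Suc_leI card_gt_0_iff)
qed

text \<open>The lower bound leaves out odd primes \<open>n\<close> with \<open>H = 1\<close>, where
  \<open>I_n n 1 = 0\<close>: all roots of such a polynomial would share one integral
  \<open>N\<close>-th power, and constant coefficient 1 or -1 would make them roots of unity, but no
  cyclotomic polynomial has odd degree above 1.\<close>

theorem theorem1p2:
  fixes n p :: nat
  assumes "n \<ge> 2"
    and "p = (LEAST q. prime q \<and> q dvd n)"
  shows "\<exists>c C :: real. c > 0 \<and> C > 0 \<and>
           (\<forall>H::nat. H \<ge> 1 \<longrightarrow>
              (\<not> (prime n \<and> odd n \<and> H = 1) \<longrightarrow> c * real H ^ (n div p) \<le> real (I_n n H)) \<and>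
              real (I_n n H) \<le> C * real H ^ (n div p))"
proof -
  note p = least_prime_divisor[OF assms]
  have p2: "p \<ge> 2" using p(1) by (rule prime_ge_2_nat)
  obtain C where C: "C > 0" "\<And>H. H \<ge> 1 \<Longrightarrow> real (I_n n H) \<le> C * real H ^ (n div p)"
    by (rule I_n_upper_bound[OF assms(1) _ p(3)]) (use p2 in auto)
  \<comment> \<open>For \<open>H \<ge> 2\<close> the number \<open>(H + 2) div 4\<close> of choices
    per coefficient is at least \<open>H / 8\<close>; for \<open>H = 1\<close> it is enough that
    \<open>c \<le> 1\<close>.\<close>
  define c where "c = (1 / 8 :: real) ^ (n div p)"
  have lower: "c * real H ^ (n div p) \<le> real (I_n n H)"
    if H: "H \<ge> 1" "\<not> (prime n \<and> odd n \<and> H = 1)" for H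
  proof (cases "H = 1")
    case True
    have "c \<le> 1" unfolding c_def by (rule power_le_one) auto
    moreover have "I_n n 1 \<ge> 1" using I_n_1_pos[OF assms(1)] H True by blast
    ultimately show ?thesis using True by simp
  next
    case False
    then have "H \<ge> 2" using H(1) by simp
    have "real H \<le> real (8 * ((H + 2) div 4))"
      unfolding of_nat_le_iff using \<open>H \<ge> 2\<close> by linarith
    then have "(1 / 8 * real H) ^ (n div p) \<le> real ((H + 2) div 4) ^ (n div p)"
      by (intro power_mono) auto
    also have "\<dots> = real (((H + 2) div 4) ^ (n div p))" by simp
    also have "\<dots> \<le> real (I_n n H)"
      unfolding of_nat_le_iff by (rule I_n_lower_bound[OF p2 p(2) \<open>H \<ge> 2\<close>]) (use assms(1) in simp)
    finally show ?thesis by (simp only: c_def power_mult_distrib)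
  qed
  show ?thesis
    by (rule exI[of _ c], rule exI[of _ C]) (use C lower in \<open>auto simp: c_def\<close>)
qed

end
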